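(* Let $X\in M_d(\mathcal A)$ be free from $M_d(\mathbb C)$ over $\mathcal D$, and let $Y_0,Y_1,\dots,Y_{d-1}$ be the diagonal decomposition of the transpose $X^t$. If $d$ is even, then the sets $\{Y_0\},\{Y_1,Y_{d-1}\},\{Y_2,Y_{d-2}\},\dots,\{Y_{d/2-1},Y_{d/2+1}\},\{Y_{d/2}\}$ form a free family over $\mathcal D$, and $\{Y_i,Y_{d-i}\}$ is an $R$-diagonal pair for $i=1,\dots,d/2-1$. If $d$ is odd, then the sets $\{Y_0\},\{Y_1,Y_{d-1}\},\{Y_2,Y_{d-2}\},\dots,\{Y_{(d-1)/2},Y_{(d+1)/2}\}$ form a free family over $\mathcal D$, and $\{Y_i,Y_{d-i}\}$ is an $R$-diagonal pair for $i=1,\dots,(d-1)/2$.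
   Context: $(\mathcal A,\tau)$ is a non-commutative probability space (a unital complex algebra with a unital linear functional), $d\ge 1$, $\mathcal D\subseteq M_d(\mathbb C)\subseteq M_d(\mathcal A)$ is the algebra of diagonal scalar matrices, and $\tilde\varphi:M_d(\mathcal A)\to\mathcal D$ is the conditional expectation $\tilde\varphi((x_{ij}))=\mathrm{diag}(\tau(x_{11}),\dots,\tau(x_{dd}))$. Subalgebras $(\mathcal A_i)_i$ of $M_d(\mathcal A)$ containing $\mathcal D$ are free over $\mathcal D$ (free with amalgamation) if $\tilde\varphi(x_1\cdots x_p)=0$ whenever $x_j\in\mathcal A_{i(j)}$, $\tilde\varphi(x_j)=0$ for all $j$, and $i(j)\ne i(j+1)$ for $1\le j\le p-1$. Sets of elements are free over $\mathcal D$ if the algebras generated by each set together with $\mathcal D$ are free over $\mathcal D$. "$X$ is free from $M_d(\mathbb C)$ over $\mathcal D$" means that the algebra generated by $X$ and $\mathcal D$ and the algebra $M_d(\mathbb C)$ are free over $\mathcal D$. The maps $\tilde\kappa_n:M_d(\mathcal A)^n\to\mathcal D$ are the $\mathcal D$-valued free cumulants with respect to $\tilde\varphi$ (defined by $\tilde\varphi(a_1\cdots a_n)=\sum_{\pi\in NC(n)}\tilde\kappa_\pi(a_1,\dots,a_n)$ with $(\tilde\kappa_\pi)$ the multiplicative family of $\mathcal D$-balanced maps). Diagonal decomposition: for $A=(a_{ij})\in M_d(\mathcal A)$, $A=A_0+\cdots+A_{d-1}$ with $(A_k)_{ij}=a_{ij}$ if $j\equiv i+k \pmod d$ and $0$ otherwise.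 The transpose is $(X^t)_{ij}=x_{ji}$. $\{y_1,y_{-1}\}$ is an $R$-diagonal pair if for all $n$ and all $\epsilon_1,\dots,\epsilon_n\in\{-1,1\}$ one has $\tilde\kappa_n(y_{\epsilon_1},\dots,y_{\epsilon_n})=0$ unless $n$ is even and $\epsilon_i=-\epsilon_{i+1}$ for $i=1,\dots,n-1$. *)

theory Defs
  imports Complex_Main "HOL-Library.Disjoint_Sets" "Jordan_Normal_Form.Matrix"
begin

section \<open>Non-commutative probability spaces\<close>

text \<open>
  A unital complex algebra is a type of class \<^class>\<open>ring_1\<close> together with an explicit
  multiplication by complex scalars, for which the product is bilinear. No positivity,
  traciality or involution is assumed of the functional.
\<close>

locale nc_prob_space = vector_space scale
  for scale :: "complex \<Rightarrow> 'a::ring_1 \<Rightarrow> 'a" +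
  fixes \<tau> :: "'a \<Rightarrow> complex"
  assumes scale_mult_left: "scale c x * y = scale c (x * y)"
    and scale_mult_right: "x * scale c y = scale c (x * y)"
    and linear_functional: "Vector_Spaces.linear scale (*) \<tau>"
    and unital_functional: "\<tau> 1 = 1"

section \<open>Square matrices over the algebra\<close>

text \<open>
  Elements of $M_d(\mathcal{A})$ are the members of \<^term>\<open>carrier_mat d d\<close>; rows and columns are
  indexed by $0, \dots, d-1$. A complex matrix is embedded by $c \mapsto c \cdot 1$ entrywise.
\<close>

definition scalar_mats :: "(complex \<Rightarrow> 'a::ring_1 \<Rightarrow> 'a) \<Rightarrow> nat \<Rightarrow> 'a mat set" where
  "scalar_mats scale d = {map_mat (\<lambda>c. scale c 1) C | C. C \<in> carrier_mat d d}"

definition diag_scalars :: "(complex \<Rightarrow> 'a::ring_1 \<Rightarrow> 'a) \<Rightarrow> nat \<Rightarrow> 'a mat set" where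
  "diag_scalars scale d =
     {map_mat (\<lambda>c. scale c 1) C | C. C \<in> carrier_mat d d \<and> diagonal_mat C}"

definition cond_exp ::
  "(complex \<Rightarrow> 'a::ring_1 \<Rightarrow> 'a) \<Rightarrow> ('a \<Rightarrow> complex) \<Rightarrow> nat \<Rightarrow> 'a mat \<Rightarrow> 'a mat" where
  "cond_exp scale \<tau> d A = mat_diag d (\<lambda>i. scale (\<tau> (A $$ (i, i))) 1)"

definition mat_list_prod :: "nat \<Rightarrow> 'a::ring_1 mat list \<Rightarrow> 'a mat" where
  "mat_list_prod d as = foldr (*) as (1\<^sub>m d)"

definition diag_part :: "nat \<Rightarrow> 'a::zero mat \<Rightarrow> nat \<Rightarrow> 'a mat" where
  "diag_part d A k = mat d d (\<lambda>(i, j). if j mod d = (i + k) mod d then A $$ (i, j) else 0)"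

section \<open>Freeness with amalgamation over the diagonal scalar matrices\<close>

inductive_set alg_over_diag ::
  "(complex \<Rightarrow> 'a::ring_1 \<Rightarrow> 'a) \<Rightarrow> nat \<Rightarrow> 'a mat set \<Rightarrow> 'a mat set"
  for scale :: "complex \<Rightarrow> 'a::ring_1 \<Rightarrow> 'a" and d :: nat and S :: "'a mat set" where
  gen: "x \<in> S \<Longrightarrow> x \<in> alg_over_diag scale d S"
| diag: "x \<in> diag_scalars scale d \<Longrightarrow> x \<in> alg_over_diag scale d S"
| add: "x \<in> alg_over_diag scale d S \<Longrightarrow> y \<in> alg_over_diag scale d S \<Longrightarrow>
    x + y \<in> alg_over_diag scale d S"
| mult: "x \<in> alg_over_diag scale d S \<Longrightarrow> y \<in> alg_over_diag scale d S \<Longrightarrow>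
    x * y \<in> alg_over_diag scale d S"
| smult: "x \<in> alg_over_diag scale d S \<Longrightarrow> map_mat (scale c) x \<in> alg_over_diag scale d S"

text \<open>
  Freeness of an indexed family; it is meant for subalgebras of $M_d(\mathcal{A})$ containing the
  diagonal scalar matrices. Words have length at least one.
\<close>

definition free_algs ::
  "(complex \<Rightarrow> 'a::ring_1 \<Rightarrow> 'a) \<Rightarrow> ('a \<Rightarrow> complex) \<Rightarrow> nat \<Rightarrow> 'i set \<Rightarrow> ('i \<Rightarrow> 'a mat set) \<Rightarrow> bool"
  where
  "free_algs scale \<tau> d I B \<longleftrightarrow>
     (\<forall>is xs. is \<noteq> [] \<longrightarrow> length xs = length is \<longrightarrow> set is \<subseteq> I \<longrightarrow>
        (\<forall>j<length is. xs ! j \<in> B (is ! j) \<and> cond_exp scale \<tau> d (xs ! j) = 0\<^sub>m d d) \<longrightarrow>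
        (\<forall>j. Suc j < length is \<longrightarrow> is ! j \<noteq> is ! Suc j) \<longrightarrow>
        cond_exp scale \<tau> d (mat_list_prod d xs) = 0\<^sub>m d d)"

definition free_sets ::
  "(complex \<Rightarrow> 'a::ring_1 \<Rightarrow> 'a) \<Rightarrow> ('a \<Rightarrow> complex) \<Rightarrow> nat \<Rightarrow> 'i set \<Rightarrow> ('i \<Rightarrow> 'a mat set) \<Rightarrow> bool"
  where
  "free_sets scale \<tau> d I S \<longleftrightarrow> free_algs scale \<tau> d I (\<lambda>i. alg_over_diag scale d (S i))"

definition free_from_scalar_mats ::
  "(complex \<Rightarrow> 'a::ring_1 \<Rightarrow> 'a) \<Rightarrow> ('a \<Rightarrow> complex) \<Rightarrow> nat \<Rightarrow> 'a mat \<Rightarrow> bool" where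
  "free_from_scalar_mats scale \<tau> d X \<longleftrightarrow>
     free_algs scale \<tau> d (UNIV :: bool set)
       (\<lambda>b. if b then alg_over_diag scale d {X} else scalar_mats scale d)"

section \<open>Free cumulants with values in the diagonal scalar matrices\<close>

definition noncrossing :: "nat set set \<Rightarrow> bool" where
  "noncrossing P \<longleftrightarrow>
     (\<forall>V\<in>P. \<forall>W\<in>P. \<forall>a\<in>V. \<forall>b\<in>W. \<forall>c\<in>V. \<forall>e\<in>W. a < b \<and> b < c \<and> c < e \<longrightarrow> V = W)"

definition NC :: "nat \<Rightarrow> nat set set set" where
  "NC n = {P. partition_on {..<n} P \<and> noncrossing P}"

text \<open>
  The increasing list of those elements of the block containing \<open>i\<close> that lie in \<open>{i..<j}\<close>.
\<close>

definition block_list :: "nat set set \<Rightarrow> nat \<Rightarrow> nat \<Rightarrow> nat list" where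
  "block_list P i j = sorted_list_of_set {v \<in> {i..<j}. \<exists>W\<in>P. i \<in> W \<and> v \<in> W}"

lemma finite_block_aux: "finite {v \<in> {i..<j}. \<exists>W\<in>P. i \<in> W \<and> v \<in> (W :: nat set)}"
  by (rule finite_subset[of _ "{i..<j}"]) auto

lemma set_block_list: "set (block_list P i j) = {v \<in> {i..<j}. \<exists>W\<in>P. i \<in> W \<and> v \<in> W}"
  unfolding block_list_def by (rule set_sorted_list_of_set[OF finite_block_aux])

lemma block_list_mem: "v \<in> set (block_list P i j) \<Longrightarrow> i \<le> v \<and> v < j"
  by (simp add: set_block_list)

text \<open>
  The multiplicative extension of a sequence of maps \<open>\<kappa>\<close> (one for each length of the
  argument list), evaluated at the restriction of \<open>P\<close> to the positions \<open>{i..<j}\<close>. If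
  $v_1 = i < v_2 < \dots < v_s$ is the block of the first position, the result is
  \[ \kappa_s(a_{v_1} g_1, \dots, a_{v_{s-1}} g_{s-1}, a_{v_s}) \cdot g_s, \]
  where $g_m$ for $m < s$ is the value at the gap strictly between $v_m$ and $v_{m+1}$, and $g_s$
  is the value at the positions after $v_s$. For a noncrossing partition every other block lies in
  one of these gaps. The test for an empty block only secures termination: it never
  succeeds for \<open>i < j\<close> if \<open>P\<close> is a partition of the positions.
\<close>

function mult_ext ::
  "nat \<Rightarrow> ('a::ring_1 mat list \<Rightarrow> 'a mat) \<Rightarrow> nat set set \<Rightarrow> 'a mat list \<Rightarrow> nat \<Rightarrow> nat \<Rightarrow> 'a mat"
  where
  "mult_ext d \<kappa> P as i j =
     (if block_list P i j = [] then 1\<^sub>m d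
      else \<kappa> (map (\<lambda>m. as ! (block_list P i j ! m) *
                      mult_ext d \<kappa> P as (Suc (block_list P i j ! m)) (block_list P i j ! Suc m))
                 [0..<length (block_list P i j) - 1]
              @ [as ! last (block_list P i j)])
           * mult_ext d \<kappa> P as (Suc (last (block_list P i j))) j)"
  by pat_completeness auto
termination
proof (relation "measure (\<lambda>(d, \<kappa>, P, as, i, j). j - i)", goal_cases)
  case 1
  then show ?case by simp
next
  case (2 d \<kappa> P as i j m)
  then have "block_list P i j ! m \<in> set (block_list P i j)"
    "block_list P i j ! Suc m \<in> set (block_list P i j)"
    by auto
  from this[THEN block_list_mem] show ?case by auto
next
  case (3 d \<kappa> P as i j)
  then have "last (block_list P i j) \<in> set (block_list P i j)" by simp
  from this[THEN block_list_mem] show ?case by auto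
qed

declare mult_ext.simps [simp del]

definition kappa_part ::
  "nat \<Rightarrow> ('a::ring_1 mat list \<Rightarrow> 'a mat) \<Rightarrow> nat set set \<Rightarrow> 'a mat list \<Rightarrow> 'a mat" where
  "kappa_part d \<kappa> P as = mult_ext d \<kappa> P as 0 (length as)"

text \<open>The type of matrices is not a monoid, hence the entrywise sum.\<close>

definition matsum :: "nat \<Rightarrow> ('b \<Rightarrow> 'a::ring_1 mat) \<Rightarrow> 'b set \<Rightarrow> 'a mat" where
  "matsum d f S = mat d d (\<lambda>ij. \<Sum>s\<in>S. f s $$ ij)"

text \<open>
  The moment-cumulant formula, solved for the term of the one-block partition: all other
  partitions involve only cumulants of shorter lists.
\<close>

function free_cumulant ::
  "(complex \<Rightarrow> 'a::ring_1 \<Rightarrow> 'a) \<Rightarrow> ('a \<Rightarrow> complex) \<Rightarrow> nat \<Rightarrow> 'a mat list \<Rightarrow> 'a mat" where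
  "free_cumulant scale \<tau> d as =
     cond_exp scale \<tau> d (mat_list_prod d as)
     - matsum d
         (\<lambda>P. kappa_part d
                (\<lambda>bs. if length bs < length as then free_cumulant scale \<tau> d bs else 0\<^sub>m d d) P as)
         (NC (length as) - {{{..<length as}}})"
  by pat_completeness auto
termination
  by (relation "measure (\<lambda>(scale, \<tau>, d, as). length as)") auto

declare free_cumulant.simps [simp del]

text \<open>
  The defining property of the cumulants: the moment-cumulant formula with the sum over all
  noncrossing partitions.
\<close>

lemma finite_NC: "finite (NC n)"
proof (rule finite_subset)
  show "NC n \<subseteq> Pow (Pow {..<n})"
    unfolding NC_def partition_on_def by auto
qed simp

lemma top_in_NC: "n > 0 \<Longrightarrow> {{..<n}} \<in> NC n"
  unfolding NC_def noncrossing_def partition_on_def by (auto simp: disjoint_def lessThan_empty_iff)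

lemma length_block_list: "length (block_list P i j) = card {v \<in> {i..<j}. \<exists>W\<in>P. i \<in> W \<and> v \<in> W}"
  unfolding block_list_def by simp

lemma length_block_list_less:
  assumes P: "P \<in> NC n - {{{..<n}}}" and n: "n > 0" and j: "j \<le> n"
  shows "length (block_list P i j) < n"
proof (rule ccontr)
  let ?V = "{v \<in> {i..<j}. \<exists>W\<in>P. i \<in> W \<and> v \<in> W}"
  assume "\<not> length (block_list P i j) < n"
  then have "card {..<n} \<le> card ?V" by (simp add: length_block_list)
  moreover have "?V \<subseteq> {..<n}" using j by auto
  ultimately have V: "?V = {..<n}" by (intro card_seteq finite_lessThan)
  have part: "partition_on {..<n} P" using P by (simp add: NC_def)
  from V n obtain W where W: "W \<in> P" "i \<in> W" by blast
  have uniq: "U = W" if "U \<in> P" "i \<in> U" for U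
    using part that W unfolding partition_on_def disjoint_def by blast
  have "{..<n} \<subseteq> W"
  proof
    fix v assume "v \<in> {..<n}"
    then have "v \<in> ?V" using V by simp
    then show "v \<in> W" using uniq by blast
  qed
  moreover have "W \<subseteq> {..<n}" using part W unfolding partition_on_def by blast
  ultimately have Weq: "W = {..<n}" by blast
  have "U = W" if "U \<in> P" for U
  proof -
    from part that have "U \<noteq> {}" "U \<subseteq> W" unfolding Weq partition_on_def by auto
    then show ?thesis
      using part that W unfolding partition_on_def disjoint_def by blast
  qed
  with W have "P = {{..<n}}" unfolding Weq[symmetric] by blast
  with P show False by simp
qed

lemma mult_ext_cong:
  assumes "\<And>bs. length bs < n \<Longrightarrow> \<kappa> bs = \<kappa>' bs"
    and "\<And>i j. j \<le> n \<Longrightarrow> length (block_list P i j) < n"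
    and "j \<le> n"
  shows "mult_ext d \<kappa> P as i j = mult_ext d \<kappa>' P as i j"
  using assms(3)
proof (induction "j - i" arbitrary: i j rule: less_induct)
  case less
  let ?b = "block_list P i j"
  show ?case
  proof (cases "?b = []")
    case True
    then show ?thesis by (simp add: mult_ext.simps[of _ _ _ _ i j])
  next
    case False
    have gap: "mult_ext d \<kappa> P as (Suc (?b ! m)) (?b ! Suc m)
        = mult_ext d \<kappa>' P as (Suc (?b ! m)) (?b ! Suc m)" if "m < length ?b - 1" for m
    proof -
      from that have "?b ! m \<in> set ?b" "?b ! Suc m \<in> set ?b" by auto
      from this[THEN block_list_mem] less.prems show ?thesis by (intro less.hyps) auto
    qed
    have "last ?b \<in> set ?b" using False by simp
    from block_list_mem[OF this] less.prems
    have rest: "mult_ext d \<kappa> P as (Suc (last ?b)) j = mult_ext d \<kappa>' P as (Suc (last ?b)) j"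
      by (intro less.hyps) auto
    let ?l = "map (\<lambda>m. as ! (?b ! m) * mult_ext d \<kappa>' P as (Suc (?b ! m)) (?b ! Suc m))
        [0..<length ?b - 1] @ [as ! last ?b]"
    have l: "map (\<lambda>m. as ! (?b ! m) * mult_ext d \<kappa> P as (Suc (?b ! m)) (?b ! Suc m))
        [0..<length ?b - 1] @ [as ! last ?b] = ?l"
      using gap by simp
    have "length ?l < n"
      using assms(2)[OF less.prems, of i] False by (cases ?b) auto
    then have "\<kappa> ?l = \<kappa>' ?l" by (rule assms(1))
    then show ?thesis
      by (simp only: mult_ext.simps[of _ _ _ _ i j] l rest)
  qed
qed

lemma free_cumulant_carrier: "free_cumulant scale \<tau> d as \<in> carrier_mat d d"
  by (subst free_cumulant.simps) (auto simp: matsum_def)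

lemma kappa_part_top:
  assumes "as \<noteq> []" "set as \<subseteq> carrier_mat d d" "\<kappa> as \<in> carrier_mat d d"
  shows "kappa_part d \<kappa> {{..<length as}} as = \<kappa> as"
proof -
  let ?n = "length as"
  have n: "?n > 0" using assms(1) by simp
  have "{v \<in> {0..<?n}. \<exists>W\<in>{{..<?n}}. 0 \<in> W \<and> v \<in> W} = {0..<?n}"
    using n by auto
  then have b: "block_list {{..<?n}} 0 ?n = [0..<?n]"
    unfolding block_list_def by (simp only: sorted_list_of_set_range)
  have e: "mult_ext d \<kappa> P as i i = 1\<^sub>m d" for P i
    by (subst mult_ext.simps) (simp add: block_list_def)
  have last: "last [0..<?n] = ?n - 1" using n by (simp add: last_conv_nth)
  have "map (\<lambda>m. as ! ([0..<?n] ! m) *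
           mult_ext d \<kappa> {{..<?n}} as (Suc ([0..<?n] ! m)) ([0..<?n] ! Suc m)) [0..<?n - 1]
        @ [as ! (?n - 1)] = map (\<lambda>m. as ! m) [0..<?n - 1] @ [as ! (?n - 1)]"
  proof -
    have "as ! ([0..<?n] ! m) * mult_ext d \<kappa> {{..<?n}} as (Suc ([0..<?n] ! m)) ([0..<?n] ! Suc m)
        = as ! m" if "m < ?n - 1" for m
    proof -
      have "as ! m \<in> carrier_mat d d" using that assms(2) by (auto simp: subset_iff)
      then show ?thesis using that by (simp add: e)
    qed
    then show ?thesis by simp
  qed
  also have "\<dots> = map (\<lambda>m. as ! m) [0..<?n]"
    using n by (metis Suc_pred' list.simps(8,9) map_append upt_Suc_append zero_le)
  also have "\<dots> = as" by (rule map_nth)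
  finally show ?thesis
    using n assms(3) unfolding kappa_part_def
    by (subst mult_ext.simps) (simp add: b e last)
qed

lemma moment_cumulant:
  assumes "as \<noteq> []" "set as \<subseteq> carrier_mat d d"
  shows "cond_exp scale \<tau> d (mat_list_prod d as) =
    matsum d (\<lambda>P. kappa_part d (free_cumulant scale \<tau> d) P as) (NC (length as))"
proof -
  let ?n = "length as" and ?K = "free_cumulant scale \<tau> d"
  let ?K' = "\<lambda>bs. if length bs < length as then ?K bs else 0\<^sub>m d d"
  have n: "?n > 0" using assms(1) by simp
  have eq: "kappa_part d ?K' P as = kappa_part d ?K P as" if "P \<in> NC ?n - {{{..<?n}}}" for P
    unfolding kappa_part_def
    by (rule mult_ext_cong[where n = ?n])
      (auto intro: length_block_list_less[OF that n])
  have "matsum d (\<lambda>P. kappa_part d ?K' P as) (NC ?n - {{{..<?n}}})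
      = matsum d (\<lambda>P. kappa_part d ?K P as) (NC ?n - {{{..<?n}}})"
    unfolding matsum_def using eq by (simp only: cong: sum.cong)
  then have "?K as = cond_exp scale \<tau> d (mat_list_prod d as)
      - matsum d (\<lambda>P. kappa_part d ?K P as) (NC ?n - {{{..<?n}}})"
    by (subst free_cumulant.simps) (simp only:)
  moreover have "matsum d (\<lambda>P. kappa_part d ?K P as) (NC ?n)
      = ?K as + matsum d (\<lambda>P. kappa_part d ?K P as) (NC ?n - {{{..<?n}}})"
    using kappa_part_top[OF assms free_cumulant_carrier[of scale \<tau> d]]
      free_cumulant_carrier[of scale \<tau> d as]
    by (intro eq_matI)
      (auto simp: matsum_def sum.remove[OF finite_NC top_in_NC[OF n]])
  ultimately show ?thesis
    by (intro eq_matI) (auto simp: matsum_def cond_exp_def mat_diag_def)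
qed

definition R_diagonal_pair ::
  "(complex \<Rightarrow> 'a::ring_1 \<Rightarrow> 'a) \<Rightarrow> ('a \<Rightarrow> complex) \<Rightarrow> nat \<Rightarrow> 'a mat \<Rightarrow> 'a mat \<Rightarrow> bool" where
  "R_diagonal_pair scale \<tau> d y y' \<longleftrightarrow>
     (\<forall>\<epsilon> :: int list. set \<epsilon> \<subseteq> {1, -1} \<longrightarrow>
        \<not> (even (length \<epsilon>) \<and> (\<forall>i. Suc i < length \<epsilon> \<longrightarrow> \<epsilon> ! i = - \<epsilon> ! Suc i)) \<longrightarrow>
        free_cumulant scale \<tau> d (map (\<lambda>e. if e = 1 then y else y') \<epsilon>) = 0\<^sub>m d d)"

end

theory Submission
  imports Defs
begin

text \<open>
  Freeness of \<open>X\<close> from the scalar matrices says that \<open>\<tau>\<close> vanishes on products of centered elements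
  \<open>b\<^sub>m\<close>, where \<open>b\<^sub>m\<close> is the \<open>(i\<^sub>m, j\<^sub>m)\<close> entry of an element of the algebra generated by \<open>X\<close> and
  \<open>j\<^sub>m \<noteq> i\<^sub>m\<^sub>+\<^sub>1\<close>: the gaps are filled by off-diagonal matrix units. An entry of a word in the \<open>Y\<^sub>k\<close> is a
  product of transposed entries of \<open>X\<close> along a walk on the integers modulo \<open>d\<close>, and two consecutive factors fail to
  compose exactly where the walk does not turn back. Hence a centered element of the algebra of \<open>Y\<^sub>k\<close> and
  \<open>Y\<^sub>d\<^sub>-\<^sub>k\<close> is a combination of products as above, one factor for each back-and-forth stretch of the walk, and
  between different \<open>k\<close> the walk does not turn back, which gives freeness.

  For R-diagonality, the free cumulants are the only maps whose free Appell polynomials, defined by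
  \<open>a\<^sub>1 \<psi>(a\<^sub>2, \<dots>, a\<^sub>n) = \<psi>(a\<^sub>1, \<dots>, a\<^sub>n) + \<Sum>\<^sub>s \<kappa>(a\<^sub>1, \<dots>, a\<^sub>s) \<psi>(a\<^sub>s\<^sub>+\<^sub>1, \<dots>, a\<^sub>n)\<close>, all have expectation \<open>0\<close>.
  If \<open>\<kappa>\<close> is replaced by \<open>0\<close> on the words that are not alternating of even length, the polynomials
  factor wherever a sign is repeated. The factors are centered stretches, so the expectations still vanish, and
  by induction on the length the replacement changes nothing.
\<close>

section \<open>The conditional expectation\<close>

context nc_prob_space
begin

sublocale tau: Vector_Spaces.linear scale "(*)" \<tau>
  by (rule linear_functional)

lemma scale_one_mult: "scale c 1 * x = scale c x"
  by (simp add: scale_mult_left)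

lemma mult_scale_one: "x * scale c 1 = scale c x"
  by (simp add: scale_mult_right)

lemma diag_scalars_iff:
  "A \<in> diag_scalars scale d \<longleftrightarrow> A \<in> carrier_mat d d \<and>
     (\<forall>i<d. \<forall>j<d. i \<noteq> j \<longrightarrow> A $$ (i, j) = 0) \<and> (\<forall>i<d. \<exists>c. A $$ (i, i) = scale c 1)"
  (is "_ \<longleftrightarrow> ?R")
proof
  assume "A \<in> diag_scalars scale d"
  then show ?R by (auto simp: diag_scalars_def diagonal_mat_def)
next
  assume R: ?R
  then obtain f where f: "\<And>i. i < d \<Longrightarrow> A $$ (i, i) = scale (f i) 1" by metis
  have "A = map_mat (\<lambda>c. scale c 1) (mat_diag d f)"
    by (rule eq_matI) (use R f in \<open>auto simp: mat_diag_def\<close>)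
  then show "A \<in> diag_scalars scale d"
    unfolding diag_scalars_def by (auto simp: diagonal_mat_def mat_diag_def intro!: exI[of _ "mat_diag d f"])
qed

lemma diag_scalars_carrier: "A \<in> diag_scalars scale d \<Longrightarrow> A \<in> carrier_mat d d"
  by (simp add: diag_scalars_iff)

lemma diag_scalars_entry: "A \<in> diag_scalars scale d \<Longrightarrow> i < d \<Longrightarrow> \<exists>c. A $$ (i, i) = scale c 1"
  by (simp add: diag_scalars_iff)

lemma mult_mat_index:
  fixes A B :: "'a mat"
  assumes "A \<in> carrier_mat d d" "B \<in> carrier_mat d d" "i < d" "j < d"
  shows "(A * B) $$ (i, j) = (\<Sum>k<d. A $$ (i, k) * B $$ (k, j))"
  using assms by (simp add: scalar_prod_def atLeast0LessThan)

lemma diag_mult_index: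
  assumes "D \<in> diag_scalars scale d" "A \<in> carrier_mat d d" "i < d" "j < d"
  shows "(D * A) $$ (i, j) = D $$ (i, i) * A $$ (i, j)"
proof -
  have "(D * A) $$ (i, j) = (\<Sum>k<d. D $$ (i, k) * A $$ (k, j))"
    using assms by (intro mult_mat_index) (auto simp: diag_scalars_iff)
  also have "\<dots> = (\<Sum>k\<in>{i}. D $$ (i, k) * A $$ (k, j))"
    using assms by (intro sum.mono_neutral_right) (auto simp: diag_scalars_iff)
  finally show ?thesis by simp
qed

lemma mult_diag_index:
  assumes "D \<in> diag_scalars scale d" "A \<in> carrier_mat d d" "i < d" "j < d"
  shows "(A * D) $$ (i, j) = A $$ (i, j) * D $$ (j, j)"
proof -
  have "(A * D) $$ (i, j) = (\<Sum>k<d. A $$ (i, k) * D $$ (k, j))"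
    using assms by (intro mult_mat_index) (auto simp: diag_scalars_iff)
  also have "\<dots> = (\<Sum>k\<in>{j}. A $$ (i, k) * D $$ (k, j))"
    using assms by (intro sum.mono_neutral_right) (auto simp: diag_scalars_iff)
  finally show ?thesis by simp
qed

lemma diag_scalars_one: "1\<^sub>m d \<in> diag_scalars scale d"
  by (auto simp: diag_scalars_iff intro: exI[of _ 1])

lemma diag_scalars_zero: "0\<^sub>m d d \<in> diag_scalars scale d"
  by (auto simp: diag_scalars_iff intro: exI[of _ 0])

lemma diag_scalars_cond_exp: "cond_exp scale \<tau> d A \<in> diag_scalars scale d"
  by (auto simp: diag_scalars_iff cond_exp_def mat_diag_def)

lemma diag_scalars_mult:
  assumes "D \<in> diag_scalars scale d" "E \<in> diag_scalars scale d"
  shows "D * E \<in> diag_scalars scale d"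
proof -
  have car: "D \<in> carrier_mat d d" "E \<in> carrier_mat d d"
    using assms by (auto simp: diag_scalars_iff)
  have "\<exists>c. (D * E) $$ (i, i) = scale c 1" if i: "i < d" for i
  proof -
    obtain c c' where "D $$ (i, i) = scale c 1" "E $$ (i, i) = scale c' 1"
      using assms[THEN diag_scalars_entry, OF i] by blast
    then have "(D * E) $$ (i, i) = scale (c * c') 1"
      using i car by (simp only: diag_mult_index[OF assms(1) car(2) i i] scale_one_mult scale_scale)
    then show ?thesis by blast
  qed
  moreover have "(D * E) $$ (i, j) = 0" if "i < d" "j < d" "i \<noteq> j" for i j
    using that assms(2) by (simp only: diag_mult_index[OF assms(1) car(2)]) (simp add: diag_scalars_iff)
  ultimately show ?thesis
    using car unfolding diag_scalars_iff by auto
qed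

lemma diag_scalars_minus:
  assumes "D \<in> diag_scalars scale d" "E \<in> diag_scalars scale d"
  shows "D - E \<in> diag_scalars scale d"
proof -
  have "\<exists>c. (D - E) $$ (i, i) = scale c 1" if "i < d" for i
    using assms that unfolding diag_scalars_iff
    by (metis carrier_matD index_minus_mat(1) scale_left_diff_distrib)
  with assms show ?thesis unfolding diag_scalars_iff by auto
qed

lemma diag_scalars_matsum:
  assumes "\<And>s. s \<in> S \<Longrightarrow> f s \<in> diag_scalars scale d"
  shows "matsum d f S \<in> diag_scalars scale d"
proof -
  have "\<exists>c. (\<Sum>s\<in>S. f s $$ (i, i)) = scale c 1" if i: "i < d" for i
  proof -
    have "\<forall>s\<in>S. \<exists>c. f s $$ (i, i) = scale c 1"
      using assms i by (auto simp: diag_scalars_iff)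
    then obtain c where "\<And>s. s \<in> S \<Longrightarrow> f s $$ (i, i) = scale (c s) 1" by metis
    then have "(\<Sum>s\<in>S. f s $$ (i, i)) = scale (sum c S) 1"
      by (simp add: scale_sum_left)
    then show ?thesis by blast
  qed
  with assms show ?thesis
    by (auto simp: diag_scalars_iff matsum_def intro!: sum.neutral)
qed

lemma cond_exp_carrier: "cond_exp scale \<tau> d A \<in> carrier_mat d d"
  by (simp add: cond_exp_def)

lemma cond_exp_index:
  "i < d \<Longrightarrow> j < d \<Longrightarrow> cond_exp scale \<tau> d A $$ (i, j) = (if i = j then scale (\<tau> (A $$ (i, i))) 1 else 0)"
  by (simp add: cond_exp_def mat_diag_def)

lemma cond_exp_diag:
  assumes "D \<in> diag_scalars scale d"
  shows "cond_exp scale \<tau> d D = D"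
proof (rule eq_matI)
  fix i j assume "i < dim_row D" "j < dim_col D"
  then have ij: "i < d" "j < d" using diag_scalars_carrier[OF assms] by auto
  with assms obtain c where "D $$ (i, i) = scale c 1" unfolding diag_scalars_iff by blast
  with ij assms show "cond_exp scale \<tau> d D $$ (i, j) = D $$ (i, j)"
    by (auto simp: cond_exp_index diag_scalars_iff tau.scale unital_functional)
qed (use diag_scalars_carrier[OF assms] in \<open>auto simp: cond_exp_def mat_diag_def\<close>)

lemma cond_exp_mult_left:
  assumes "D \<in> diag_scalars scale d" "A \<in> carrier_mat d d"
  shows "cond_exp scale \<tau> d (D * A) = D * cond_exp scale \<tau> d A"
proof (rule eq_matI)
  fix i j assume "i < dim_row (D * cond_exp scale \<tau> d A)" "j < dim_col (D * cond_exp scale \<tau> d A)"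
  then have ij: "i < d" "j < d" using diag_scalars_carrier[OF assms(1)] carrier_matD[OF cond_exp_carrier] by auto
  with assms obtain c where "D $$ (i, i) = scale c 1" unfolding diag_scalars_iff by blast
  with ij show "cond_exp scale \<tau> d (D * A) $$ (i, j) = (D * cond_exp scale \<tau> d A) $$ (i, j)"
    by (simp only: diag_mult_index[OF assms] diag_mult_index[OF assms(1) cond_exp_carrier] cond_exp_index)
      (simp add: scale_one_mult tau.scale)
qed (use assms(2) diag_scalars_carrier[OF assms(1)] in \<open>auto simp: cond_exp_def mat_diag_def\<close>)

lemma cond_exp_mult_right:
  assumes "D \<in> diag_scalars scale d" "A \<in> carrier_mat d d"
  shows "cond_exp scale \<tau> d (A * D) = cond_exp scale \<tau> d A * D"
proof (rule eq_matI)
  fix i j assume "i < dim_row (cond_exp scale \<tau> d A * D)" "j < dim_col (cond_exp scale \<tau> d A * D)"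
  then have ij: "i < d" "j < d" using diag_scalars_carrier[OF assms(1)] carrier_matD[OF cond_exp_carrier] by auto
  with assms obtain c where "D $$ (j, j) = scale c 1" unfolding diag_scalars_iff by blast
  with ij show "cond_exp scale \<tau> d (A * D) $$ (i, j) = (cond_exp scale \<tau> d A * D) $$ (i, j)"
    by (simp only: mult_diag_index[OF assms] mult_diag_index[OF assms(1) cond_exp_carrier] cond_exp_index)
      (simp add: mult_scale_one tau.scale mult.commute)
qed (use assms(2) diag_scalars_carrier[OF assms(1)] in \<open>auto simp: cond_exp_def mat_diag_def\<close>)

lemma cond_exp_matsum:
  "cond_exp scale \<tau> d (matsum d f S) = matsum d (\<lambda>s. cond_exp scale \<tau> d (f s)) S"
  by (rule eq_matI)
    (auto simp: matsum_def cond_exp_def mat_diag_def tau.sum scale_sum_left)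

lemma cond_exp_minus:
  assumes "A \<in> carrier_mat d d" "B \<in> carrier_mat d d"
  shows "cond_exp scale \<tau> d (A - B) = cond_exp scale \<tau> d A - cond_exp scale \<tau> d B"
  by (rule eq_matI) (use assms in \<open>auto simp: cond_exp_def mat_diag_def tau.diff scale_left_diff_distrib\<close>)

lemma matsum_carrier: "matsum d f S \<in> carrier_mat d d"
  by (simp add: matsum_def)

lemma mult_matsum:
  fixes A :: "'a mat"
  assumes "A \<in> carrier_mat d d" "\<And>s. s \<in> S \<Longrightarrow> f s \<in> carrier_mat d d"
  shows "A * matsum d f S = matsum d (\<lambda>s. A * f s) S"
proof (rule eq_matI)
  fix i j assume "i < dim_row (matsum d (\<lambda>s. A * f s) S)" "j < dim_col (matsum d (\<lambda>s. A * f s) S)"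
  then have ij: "i < d" "j < d" by (auto simp: matsum_def)
  have "(A * matsum d f S) $$ (i, j) = (\<Sum>k<d. A $$ (i, k) * (\<Sum>s\<in>S. f s $$ (k, j)))"
    using ij assms(1) by (simp add: mult_mat_index[OF assms(1) matsum_carrier]) (simp add: matsum_def)
  also have "\<dots> = (\<Sum>s\<in>S. \<Sum>k<d. A $$ (i, k) * f s $$ (k, j))"
    by (subst sum.swap) (simp add: sum_distrib_left)
  also have "\<dots> = matsum d (\<lambda>s. A * f s) S $$ (i, j)"
    using ij assms by (auto simp: matsum_def mult_mat_index simp del: index_mult_mat(1) intro!: sum.cong)
  finally show "(A * matsum d f S) $$ (i, j) = matsum d (\<lambda>s. A * f s) S $$ (i, j)" .
qed (use assms in \<open>auto simp: matsum_def\<close>)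

end

section \<open>Multiplicative extensions and free cumulants\<close>

lemma mult_ext_empty: "j \<le> i \<Longrightarrow> mult_ext d \<kappa> P as i j = 1\<^sub>m d"
  by (subst mult_ext.simps) (simp add: block_list_def)

lemma mult_ext_cong_blocks:
  assumes "\<And>i' j'. i \<le> i' \<Longrightarrow> j' \<le> j \<Longrightarrow> block_list P i' j' = block_list P' i' j'"
  shows "mult_ext d \<kappa> P as i j = mult_ext d \<kappa> P' as i j"
  using assms
proof (induction "j - i" arbitrary: i j rule: less_induct)
  case less
  let ?b = "block_list P i j"
  have b: "block_list P' i j = ?b" using less.prems[of i j] by simp
  show ?case
  proof (cases "?b = []")
    case True
    then show ?thesis using b by (simp add: mult_ext.simps[of _ _ _ _ i j])
  next
    case False
    have gap: "mult_ext d \<kappa> P as (Suc (?b ! m)) (?b ! Suc m)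
        = mult_ext d \<kappa> P' as (Suc (?b ! m)) (?b ! Suc m)" if "m < length ?b - 1" for m
    proof -
      from that have "?b ! m \<in> set ?b" "?b ! Suc m \<in> set ?b" by auto
      from this[THEN block_list_mem] show ?thesis by (intro less.hyps less.prems) auto
    qed
    have "last ?b \<in> set ?b" using False by simp
    from block_list_mem[OF this]
    have rest: "mult_ext d \<kappa> P as (Suc (last ?b)) j = mult_ext d \<kappa> P' as (Suc (last ?b)) j"
      by (intro less.hyps less.prems) auto
    have l: "map (\<lambda>m. as ! (?b ! m) * mult_ext d \<kappa> P as (Suc (?b ! m)) (?b ! Suc m))
        [0..<length ?b - 1] = map (\<lambda>m. as ! (?b ! m) * mult_ext d \<kappa> P' as (Suc (?b ! m)) (?b ! Suc m))
        [0..<length ?b - 1]"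
      using gap by simp
    show ?thesis
      by (simp only: mult_ext.simps[of _ _ _ _ i j] l rest b)
  qed
qed

text \<open>A block that misses the interval never shows up in a block list inside it. This lets a
  new block be added over marked positions without changing the values at the gaps between
  them.\<close>

lemma mult_ext_insert_block:
  assumes "\<And>v. v \<in> {i..<j} \<Longrightarrow> v \<notin> W"
  shows "mult_ext d \<kappa> (insert W P) as i j = mult_ext d \<kappa> P as i j"
proof (rule mult_ext_cong_blocks)
  fix i' j' assume ij: "i \<le> i'" "j' \<le> j"
  have "{v \<in> {i'..<j'}. \<exists>U\<in>insert W P. i' \<in> U \<and> v \<in> U} = {v \<in> {i'..<j'}. \<exists>U\<in>P. i' \<in> U \<and> v \<in> U}"
    using assms ij by fastforce
  then show "block_list (insert W P) i' j' = block_list P i' j'"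
    by (simp add: block_list_def)
qed

section \<open>Diagonal values and right linearity of the cumulants\<close>

context nc_prob_space
begin

lemma mult_ext_diag_scalars:
  assumes "\<And>bs. \<kappa> bs \<in> diag_scalars scale d"
  shows "mult_ext d \<kappa> P as i j \<in> diag_scalars scale d"
proof (induction "j - i" arbitrary: i rule: less_induct)
  case less
  let ?b = "block_list P i j"
  show ?case
  proof (cases "?b = []")
    case True
    then show ?thesis by (simp add: mult_ext.simps[of _ _ _ _ i j] diag_scalars_one)
  next
    case False
    then have "last ?b \<in> set ?b" by simp
    from block_list_mem[OF this] have "j - Suc (last ?b) < j - i" by auto
    from less[OF this] show ?thesis
      using False by (subst mult_ext.simps) (auto intro!: diag_scalars_mult assms)
  qed
qed

lemma kappa_part_diag_scalars:
  "(\<And>bs. \<kappa> bs \<in> diag_scalars scale d) \<Longrightarrow> kappa_part d \<kappa> P as \<in> diag_scalars scale d"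
  unfolding kappa_part_def by (rule mult_ext_diag_scalars)

lemma free_cumulant_diag_scalars: "free_cumulant scale \<tau> d as \<in> diag_scalars scale d"
proof (induction as rule: length_induct)
  case (1 as)
  then have "(if length bs < length as then free_cumulant scale \<tau> d bs else 0\<^sub>m d d) \<in> diag_scalars scale d"
    for bs by (simp add: diag_scalars_zero)
  then show ?case
    by (subst free_cumulant.simps)
      (intro diag_scalars_minus diag_scalars_cond_exp diag_scalars_matsum kappa_part_diag_scalars)
qed

text \<open>The last position of the word lies in no inner gap of the first block, since such a gap
  ends before a block position. An interval reaching that position has it either as the last element
  of the block, where the linearity of \<open>\<kappa>\<close> pulls \<open>D\<close> out, or in the
  remainder, where induction applies. On an empty interval the value is the identity and carries no
  \<open>D\<close>, hence the test \<open>i < j\<close>.\<close>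

lemma mult_ext_mult_last:
  fixes bs :: "'a mat list"
  assumes part: "partition_on {..<Suc (length bs)} P"
    and car: "set bs \<subseteq> carrier_mat d d" "b \<in> carrier_mat d d" and D: "D \<in> diag_scalars scale d"
    and \<kappa>: "\<And>cs. \<kappa> cs \<in> diag_scalars scale d"
      "\<And>cs c. set cs \<subseteq> carrier_mat d d \<Longrightarrow> c \<in> carrier_mat d d \<Longrightarrow> \<kappa> (cs @ [c * D]) = \<kappa> (cs @ [c]) * D"
    and j: "j \<le> Suc (length bs)"
  shows "mult_ext d \<kappa> P (bs @ [b * D]) i j =
    (if i < j \<and> j = Suc (length bs) then mult_ext d \<kappa> P (bs @ [b]) i j * D
     else mult_ext d \<kappa> P (bs @ [b]) i j)"
  using j
proof (induction "j - i" arbitrary: i j rule: less_induct)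
  case less
  let ?b = "block_list P i j"
  have MC: "mult_ext d \<kappa> P as i j \<in> carrier_mat d d" for as i j
    by (rule diag_scalars_carrier[OF mult_ext_diag_scalars[of \<kappa> d, OF \<kappa>(1)]])
  have \<kappa>C: "\<kappa> cs \<in> carrier_mat d d" for cs
    by (rule diag_scalars_carrier[OF \<kappa>(1)])
  note DC = diag_scalars_carrier[OF D]
  show ?case
  proof (cases "i < j")
    case False
    then show ?thesis by (simp add: mult_ext_empty)
  next
    case True
    with less.prems part obtain U where "U \<in> P" "i \<in> U"
      unfolding partition_on_def by (metis UnionE lessThan_iff order_less_le_trans)
    with True have "i \<in> set ?b" by (auto simp: set_block_list)
    then have ne: "?b \<noteq> []" by auto
    have sorted: "sorted_wrt (<) ?b" by (simp add: block_list_def strict_sorted_iff)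
    define l where "l as = map (\<lambda>m. as ! (?b ! m) *
        mult_ext d \<kappa> P as (Suc (?b ! m)) (?b ! Suc m)) [0..<length ?b - 1]" for as
    have gap: "(bs @ [b * D]) ! (?b ! m) * mult_ext d \<kappa> P (bs @ [b * D]) (Suc (?b ! m)) (?b ! Suc m)
        = (bs @ [b]) ! (?b ! m) * mult_ext d \<kappa> P (bs @ [b]) (Suc (?b ! m)) (?b ! Suc m)"
      "(bs @ [b]) ! (?b ! m) \<in> carrier_mat d d"
      if m: "m < length ?b - 1" for m
    proof -
      from m have "?b ! m \<in> set ?b" "?b ! Suc m \<in> set ?b" by auto
      note mem = this[THEN block_list_mem]
      have lt: "?b ! m < ?b ! Suc m" using sorted m by (simp add: sorted_wrt_nth_less)
      with mem less.prems have small: "?b ! m < length bs" "?b ! Suc m < Suc (length bs)" by auto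
      have "mult_ext d \<kappa> P (bs @ [b * D]) (Suc (?b ! m)) (?b ! Suc m) =
        mult_ext d \<kappa> P (bs @ [b]) (Suc (?b ! m)) (?b ! Suc m)"
        using less.hyps[of "?b ! Suc m" "Suc (?b ! m)"] mem lt small by auto
      with small show "(bs @ [b * D]) ! (?b ! m) * mult_ext d \<kappa> P (bs @ [b * D]) (Suc (?b ! m)) (?b ! Suc m)
        = (bs @ [b]) ! (?b ! m) * mult_ext d \<kappa> P (bs @ [b]) (Suc (?b ! m)) (?b ! Suc m)"
        by (simp add: nth_append)
      show "(bs @ [b]) ! (?b ! m) \<in> carrier_mat d d"
        using small car by (auto simp: nth_append subset_iff)
    qed
    have l: "l (bs @ [b * D]) = l (bs @ [b])"
      unfolding l_def by (rule map_cong) (use gap(1) in auto)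
    have lC: "set (l (bs @ [b])) \<subseteq> carrier_mat d d"
      unfolding l_def using gap(2) MC by (auto intro!: mult_carrier_mat[of _ d d])
    have unf: "mult_ext d \<kappa> P as i j = \<kappa> (l as @ [as ! last ?b]) * mult_ext d \<kappa> P as (Suc (last ?b)) j"
      for as using ne by (subst mult_ext.simps) (simp add: l_def)
    have "last ?b \<in> set ?b" using ne by simp
    note last = block_list_mem[OF this]
    show ?thesis
    proof (cases "last ?b = length bs")
      case True
      with last less.prems have j: "j = Suc (length bs)" by simp
      have "mult_ext d \<kappa> P (bs @ [b * D]) i j = \<kappa> (l (bs @ [b]) @ [b * D])"
        unfolding unf l using True j by (simp add: mult_ext_empty right_mult_one_mat[OF \<kappa>C])
      moreover have "mult_ext d \<kappa> P (bs @ [b]) i j = \<kappa> (l (bs @ [b]) @ [b])"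
        unfolding unf l using True j by (simp add: mult_ext_empty right_mult_one_mat[OF \<kappa>C])
      ultimately show ?thesis
        using \<kappa>(2)[OF lC car(2)] \<open>i < j\<close> j by simp
    next
      case False
      with last less.prems have lt: "last ?b < length bs" by auto
      have "mult_ext d \<kappa> P (bs @ [b * D]) (Suc (last ?b)) j =
        (if j = Suc (length bs) then mult_ext d \<kappa> P (bs @ [b]) (Suc (last ?b)) j * D
         else mult_ext d \<kappa> P (bs @ [b]) (Suc (last ?b)) j)"
        using less.hyps[of j "Suc (last ?b)"] last less.prems lt by auto
      with lt \<open>i < j\<close> show ?thesis
        unfolding unf l by (cases "j = Suc (length bs)")
          (simp_all only: assoc_mult_mat[OF \<kappa>C MC DC] nth_append simp_thms if_True if_False)
    qed
  qed
qed

lemma matsum_cong: "(\<And>s. s \<in> S \<Longrightarrow> f s = g s) \<Longrightarrow> matsum d f S = matsum d g S"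
  by (simp add: matsum_def cong: sum.cong)

lemma matsum_mult_diag:
  assumes "D \<in> diag_scalars scale d" "\<And>s. s \<in> S \<Longrightarrow> f s \<in> carrier_mat d d"
  shows "matsum d (\<lambda>s. f s * D) S = matsum d f S * D"
proof (rule eq_matI)
  note DC = diag_scalars_carrier[OF assms(1)]
  fix i j assume "i < dim_row (matsum d f S * D)" "j < dim_col (matsum d f S * D)"
  then have ij: "i < d" "j < d" using DC by (auto simp: matsum_def)
  have "(\<Sum>s\<in>S. (f s * D) $$ (i, j)) = (\<Sum>s\<in>S. f s $$ (i, j) * D $$ (j, j))"
    by (rule sum.cong) (use mult_diag_index[OF assms(1) assms(2) ij] in auto)
  also have "\<dots> = (matsum d f S * D) $$ (i, j)"
    by (subst mult_diag_index[OF assms(1) matsum_carrier ij])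
      (use ij in \<open>simp add: matsum_def sum_distrib_right\<close>)
  finally show "matsum d (\<lambda>s. f s * D) S $$ (i, j) = (matsum d f S * D) $$ (i, j)"
    using ij by (simp add: matsum_def)
qed (use diag_scalars_carrier[OF assms(1)] in \<open>auto simp: matsum_def\<close>)

lemma mat_list_prod_carrier:
  "set as \<subseteq> carrier_mat d d \<Longrightarrow> mat_list_prod d as \<in> carrier_mat d d"
  by (induction as) (auto simp: mat_list_prod_def)

lemma mat_list_prod_append:
  assumes "set as \<subseteq> carrier_mat d d" "set bs \<subseteq> carrier_mat d d"
  shows "mat_list_prod d (as @ bs) = mat_list_prod d as * mat_list_prod d bs"
  using assms(1)
proof (induction as)
  case Nil
  then show ?case using mat_list_prod_carrier[OF assms(2)] by (simp add: mat_list_prod_def)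
next
  case (Cons a as)
  have "mat_list_prod d ((a # as) @ bs) = a * (mat_list_prod d as * mat_list_prod d bs)"
    using Cons by (simp add: mat_list_prod_def)
  also have "\<dots> = a * mat_list_prod d as * mat_list_prod d bs"
    using Cons.prems mat_list_prod_carrier[of as d] mat_list_prod_carrier[OF assms(2)]
    by (intro assoc_mult_mat[symmetric]) auto
  finally show ?case by (simp add: mat_list_prod_def)
qed

text \<open>Both ingredients of the recursion for the cumulants are right linear over the diagonal
  scalars in the last letter: the moment because \<open>cond_exp\<close> is a bimodule map, and each
  partition term by \<open>mult_ext_mult_last\<close>, with induction supplying the linearity of the
  shorter cumulants.\<close>

lemma free_cumulant_mult_last:
  assumes D: "D \<in> diag_scalars scale d"
  shows "set bs \<subseteq> carrier_mat d d \<Longrightarrow> b \<in> carrier_mat d d \<Longrightarrow>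
    free_cumulant scale \<tau> d (bs @ [b * D]) = free_cumulant scale \<tau> d (bs @ [b]) * D"
proof (induction bs arbitrary: b rule: length_induct)
  case (1 bs)
  note DC = diag_scalars_carrier[OF D]
  let ?n = "Suc (length bs)"
  let ?K = "\<lambda>bs. if length bs < ?n then free_cumulant scale \<tau> d bs else 0\<^sub>m d d"
  have Kd: "?K cs \<in> diag_scalars scale d" for cs
    by (simp add: free_cumulant_diag_scalars diag_scalars_zero)
  \<comment> \<open>The truncation inherits linearity in the last argument: by induction below the
    length bound, and trivially from there on, where both sides are zero.\<close>
  have Kl: "?K (cs @ [c * D]) = ?K (cs @ [c]) * D"
    if "set cs \<subseteq> carrier_mat d d" "c \<in> carrier_mat d d" for cs c
    using 1(1) that DC by auto
  have "kappa_part d ?K P (bs @ [b * D]) = kappa_part d ?K P (bs @ [b]) * D" if "P \<in> NC ?n" for P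
    unfolding kappa_part_def
    by (subst mult_ext_mult_last[OF _ 1(2) 1(3) D Kd Kl]) (use that in \<open>auto simp: NC_def\<close>)
  then have ms: "matsum d (\<lambda>P. kappa_part d ?K P (bs @ [b * D])) (NC ?n - {{{..<?n}}}) =
      matsum d (\<lambda>P. kappa_part d ?K P (bs @ [b])) (NC ?n - {{{..<?n}}}) * D"
    by (subst matsum_mult_diag[OF D, symmetric])
      (auto intro!: diag_scalars_carrier[OF kappa_part_diag_scalars[OF Kd]] matsum_cong)
  have pc: "mat_list_prod d (bs @ [b]) \<in> carrier_mat d d"
    using 1 by (intro mat_list_prod_carrier) auto
  have "mat_list_prod d (bs @ [b * D]) = mat_list_prod d (bs @ [b]) * D"
    using 1 DC mat_list_prod_carrier[OF 1(2)]
    by (simp add: mat_list_prod_append) (simp add: mat_list_prod_def assoc_mult_mat[of _ d d _ d _ d]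
        right_mult_one_mat[of _ d d])
  then have "cond_exp scale \<tau> d (mat_list_prod d (bs @ [b * D])) =
      cond_exp scale \<tau> d (mat_list_prod d (bs @ [b])) * D"
    using cond_exp_mult_right[OF D pc] by simp
  with ms show ?case
    by (simp add: free_cumulant.simps[of scale \<tau> d "bs @ _"])
      (rule minus_mult_distrib_mat[OF cond_exp_carrier matsum_carrier DC, symmetric])
qed

end

section \<open>Free Appell polynomials\<close>

text \<open>
  Anshelevich's free Appell polynomials, for letters \<open>b\<close> that stand for the matrices \<open>f b\<close>.
\<close>

function appell :: "nat \<Rightarrow> ('b \<Rightarrow> 'a::ring_1 mat) \<Rightarrow> ('b list \<Rightarrow> 'a mat) \<Rightarrow> 'b list \<Rightarrow> 'a mat" where
  "appell d f \<kappa> [] = 1\<^sub>m d"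
| "appell d f \<kappa> (b # bs) = f b * appell d f \<kappa> bs
     - matsum d (\<lambda>s. \<kappa> (take (Suc s) (b # bs)) * appell d f \<kappa> (drop s bs)) {..length bs}"
  by pat_completeness auto
termination
  by (relation "measure (\<lambda>(d, f, \<kappa>, bs). length bs)") auto

lemma appell_carrier: "appell d f \<kappa> bs \<in> carrier_mat d d"
  by (cases bs) (auto simp: matsum_def)

text \<open>When \<open>\<kappa>\<close> takes diagonal scalar values, so does a partition at the
  gaps between marked positions, and each such value is absorbed by the mark on its left. The
  appended \<open>length as\<close> makes the last gap extend to the end of the word.\<close>

definition gap_args :: "nat \<Rightarrow> ('a::ring_1 mat list \<Rightarrow> 'a mat) \<Rightarrow> nat set set \<Rightarrow> 'a mat list \<Rightarrow> nat list \<Rightarrow> 'a mat list"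
  where "gap_args d \<kappa> P as vs =
    map (\<lambda>m. as ! (vs ! m) * mult_ext d \<kappa> P as (Suc (vs ! m)) ((vs @ [length as]) ! Suc m)) [0..<length vs]"

lemma length_gap_args [simp]: "length (gap_args d \<kappa> P as vs) = length vs"
  by (simp add: gap_args_def)

lemma gap_args_Nil: "gap_args d \<kappa> P as [] = []"
  by (simp add: gap_args_def)

lemma gap_args_Cons:
  "gap_args d \<kappa> P as (v # vs) =
     (as ! v * mult_ext d \<kappa> P as (Suc v) (hd (vs @ [length as]))) # gap_args d \<kappa> P as vs"
  by (rule nth_equalityI) (auto simp: gap_args_def nth_Cons hd_conv_nth nth_append less_Suc_eq split: nat.splits)

lemma drop_gap_args: "drop s (gap_args d \<kappa> P as vs) = gap_args d \<kappa> P as (drop s vs)"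
  by (induction vs arbitrary: s) (auto simp: gap_args_Nil gap_args_Cons drop_Cons split: nat.splits)

text \<open>
  Reading a word from the right, the marked positions \<open>vs\<close> are those not yet assigned to a block. A further
  letter \<open>i\<close> is either marked as well or closes a block together with an initial segment of \<open>vs\<close>.
\<close>

definition marked_NC :: "nat \<Rightarrow> nat \<Rightarrow> (nat list \<times> nat set set) set" where
  "marked_NC n i = {(vs, P). sorted_wrt (<) vs \<and> set vs \<subseteq> {i..<n} \<and>
     partition_on ({i..<n} - set vs) P \<and> noncrossing P \<and>
     (\<forall>U\<in>P. \<forall>a\<in>U. \<forall>b\<in>U. \<forall>v\<in>set vs. \<not> (a < v \<and> v < b))}"

lemma marked_NC_iff:
  "(vs, P) \<in> marked_NC n i \<longleftrightarrow> sorted_wrt (<) vs \<and> set vs \<subseteq> {i..<n} \<and>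
     partition_on ({i..<n} - set vs) P \<and> noncrossing P \<and>
     (\<forall>U\<in>P. \<forall>a\<in>U. \<forall>b\<in>U. \<forall>v\<in>set vs. \<not> (a < v \<and> v < b))"
  by (simp add: marked_NC_def)

lemma finite_marked_NC: "finite (marked_NC n i)"
proof (rule finite_subset)
  show "marked_NC n i \<subseteq> {vs. set vs \<subseteq> {..<n} \<and> distinct vs} \<times> Pow (Pow {..<n})"
    by (auto simp: marked_NC_def partition_on_def strict_sorted_iff)
  show "finite ({vs. set vs \<subseteq> {..<n} \<and> distinct vs} \<times> Pow (Pow {..<n}))"
    by (intro finite_cartesian_product finite_subset_distinct) auto
qed

lemma marked_NC_end: "marked_NC n n = {([], {})}"
  by (auto simp: marked_NC_def noncrossing_def partition_on_def)

lemma marked_NC_Nil: "([], P) \<in> marked_NC n 0 \<longleftrightarrow> P \<in> NC n"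
  by (simp add: marked_NC_def NC_def atLeast0LessThan)

lemma partition_on_mem: "partition_on A P \<Longrightarrow> U \<in> P \<Longrightarrow> a \<in> U \<Longrightarrow> a \<in> A"
  by (auto simp: partition_on_def)

lemma marked_NC_mark:
  assumes "i < n"
  shows "(i # vs, P) \<in> marked_NC n i \<longleftrightarrow> (vs, P) \<in> marked_NC n (Suc i)"
proof -
  have "{i..<n} - set (i # vs) = {Suc i..<n} - set vs" by auto
  moreover have "a > i" if "partition_on ({Suc i..<n} - set vs) P" "U \<in> P" "a \<in> U" for U a
    using partition_on_mem[OF that] by simp
  moreover have "sorted_wrt (<) (i # vs) \<and> set (i # vs) \<subseteq> {i..<n} \<longleftrightarrow>
      sorted_wrt (<) vs \<and> set vs \<subseteq> {Suc i..<n}"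
    using assms by (auto simp: subset_iff Suc_le_eq)
  ultimately show ?thesis
    unfolding marked_NC_iff by (auto dest: less_asym)
qed

section \<open>Closing and reopening the block of the first position\<close>

definition close_block :: "nat \<Rightarrow> nat \<Rightarrow> nat list \<times> nat set set \<Rightarrow> nat list \<times> nat set set" where
  "close_block i s = (\<lambda>(vs, P). (drop s vs, insert (insert i (set (take s vs))) P))"

text \<open>The inverse of \<open>close_block\<close>: the block of \<open>i\<close> is dissolved
  and its other elements become marks again. They are put in front of \<open>vs\<close> because,
  with \<open>i\<close> to the left of all marks, an element to the right of a mark would make the
  block straddle that mark.\<close>

definition open_block :: "nat \<Rightarrow> nat list \<times> nat set set \<Rightarrow> nat list \<times> nat set set" where
  "open_block i = (\<lambda>(vs, P). let W = (THE W. W \<in> P \<and> i \<in> W) in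
     (sorted_list_of_set (W - {i}) @ vs, P - {W}))"

lemma sorted_take_less_drop:
  assumes "sorted_wrt (<) (vs :: nat list)" "a \<in> set (take s vs)" "b \<in> set (drop s vs)"
  shows "a < b"
  using assms by (metis append_take_drop_id sorted_wrt_append)

text \<open>Apart from \<open>i\<close>, the new block consists of former marks, which no block of
  \<open>P\<close> straddles, and \<open>i\<close> lies to the left of everything; hence nothing
  crosses. The remaining marks are all larger than the absorbed ones, so the new block straddles
  none of them.\<close>

lemma close_block_mem:
  assumes vP: "(vs, P) \<in> marked_NC n (Suc i)" and i: "i < n"
  shows "close_block i s (vs, P) \<in> marked_NC n i"
    and "i \<notin> set (fst (close_block i s (vs, P)))"
proof -
  let ?W = "insert i (set (take s vs))"
  from vP have so: "sorted_wrt (<) vs" and sub: "set vs \<subseteq> {Suc i..<n}"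
    and part: "partition_on ({Suc i..<n} - set vs) P" and nc: "noncrossing P"
    and st: "\<And>U a b v. U \<in> P \<Longrightarrow> a \<in> U \<Longrightarrow> b \<in> U \<Longrightarrow> v \<in> set vs \<Longrightarrow> a < v \<Longrightarrow> v < b \<Longrightarrow> False"
    unfolding marked_NC_iff by blast+
  have vs: "set vs = set (take s vs) \<union> set (drop s vs)"
    by (metis append_take_drop_id set_append)
  have tl: "a < b" if "a \<in> set (take s vs)" "b \<in> set (drop s vs)" for a b
    using sorted_take_less_drop[OF so that] .
  have P: "a > i" "a \<notin> set vs" if "U \<in> P" "a \<in> U" for U a
    using partition_on_mem[OF part that] by auto
  have "({i..<n} - set (drop s vs)) = ?W \<union> ({Suc i..<n} - set vs)"
  proof -
    have "set (take s vs) \<inter> set (drop s vs) = {}" using tl by blast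
    moreover have "{Suc i..<n} = {i..<n} - {i}" by auto
    moreover have "i \<notin> set vs" "i \<in> {i..<n}" "set vs \<subseteq> {i..<n}" using sub i by auto
    ultimately show ?thesis using vs by blast
  qed
  moreover have "partition_on (?W \<union> ({Suc i..<n} - set vs)) (insert ?W P)"
  proof -
    have un: "\<Union> P = {Suc i..<n} - set vs" using part by (simp add: partition_on_def)
    have d: "?W \<inter> ({Suc i..<n} - set vs) = {}" using vs by auto
    then have "disjnt ?W (\<Union> P)" by (simp only: un disjnt_def)
    then show ?thesis
    proof (rule iffD2[OF partition_on_insert], intro conjI)
      have "?W \<union> ({Suc i..<n} - set vs) - ?W = {Suc i..<n} - set vs" using d by blast
      then show "partition_on (?W \<union> ({Suc i..<n} - set vs) - ?W) P" using part by (simp only:)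
    qed (rule Un_upper1, rule insert_not_empty)
  qed
  moreover have "noncrossing (insert ?W P)"
  proof -
    have 1: False if "a \<in> ?W" "c \<in> ?W" "U \<in> P" "b \<in> U" "e \<in> U" "a < b" "b < c" "c < e" for a b c e U
    proof -
      have "c \<noteq> i" using P(1)[OF that(3,4)] that by simp
      then show False using st[OF that(3-5), of c] that vs by auto
    qed
    have 2: False if "b \<in> ?W" "e \<in> ?W" "U \<in> P" "a \<in> U" "c \<in> U" "a < b" "b < c" "c < e" for a b c e U
    proof -
      have "b \<noteq> i" using P(1)[OF that(3,4)] that by simp
      then show False using st[OF that(3-5), of b] that vs by auto
    qed
    show ?thesis
      unfolding noncrossing_def
    proof (intro ballI impI)
      fix V W a b c e
      assume *: "V \<in> insert ?W P" "W \<in> insert ?W P" "a \<in> V" "b \<in> W" "c \<in> V" "e \<in> W"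
        "a < b \<and> b < c \<and> c < e"
      consider "V = ?W" "W = ?W" | "V = ?W" "W \<in> P" | "V \<in> P" "W = ?W" | "V \<in> P" "W \<in> P"
        using *(1,2) by blast
      then show "V = W"
      proof cases
        case 2 then show ?thesis using 1[of a c W b e] * by blast
      next
        case 3 then show ?thesis using 2[of b e V a c] * by blast
      next
        case 4
        from nc[unfolded noncrossing_def, rule_format, OF this *(3-7)] show ?thesis .
      qed simp
    qed
  qed
  moreover have "\<not> (a < v \<and> v < b)"
    if "U \<in> insert ?W P" "a \<in> U" "b \<in> U" "v \<in> set (drop s vs)" for U a b v
  proof -
    have v: "v \<in> set vs" using that(4) by (rule in_set_dropD)
    with sub have iv: "i < v" by auto
    from that(1) show ?thesis
    proof (rule insertE)
      assume "U = ?W"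
      with that(3) have "b = i \<or> b \<in> set (take s vs)" by simp
      with iv tl[OF _ that(4)] have "b < v" by blast
      then show ?thesis by simp
    next
      assume "U \<in> P"
      from st[OF this that(2,3) v] show ?thesis by blast
    qed
  qed
  moreover have "sorted_wrt (<) (drop s vs)" using so by (rule sorted_wrt_drop)
  moreover have "set (drop s vs) \<subseteq> {i..<n}" using sub vs by auto
  ultimately show "close_block i s (vs, P) \<in> marked_NC n i"
    unfolding close_block_def case_prod_conv marked_NC_iff by simp
  show "i \<notin> set (fst (close_block i s (vs, P)))"
    using sub vs by (auto simp: close_block_def)
qed

lemma block_of_close_block:
  assumes vP: "(vs, P) \<in> marked_NC n (Suc i)"
  shows "(THE W. W \<in> insert (insert i (set (take s vs))) P \<and> i \<in> W) = insert i (set (take s vs))"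
    and "insert i (set (take s vs)) \<notin> P"
proof -
  have "partition_on ({Suc i..<n} - set vs) P" using vP by (simp add: marked_NC_iff)
  then have P: "i \<notin> U" if "U \<in> P" for U
    using partition_on_mem[OF _ that, of _ i] by force
  then show "insert i (set (take s vs)) \<notin> P" by blast
  show "(THE W. W \<in> insert (insert i (set (take s vs))) P \<and> i \<in> W) = insert i (set (take s vs))"
    by (rule the_equality) (use P in auto)
qed

lemma open_close_block:
  assumes vP: "(vs, P) \<in> marked_NC n (Suc i)"
  shows "open_block i (close_block i s (vs, P)) = (vs, P)"
proof -
  from vP have so: "sorted_wrt (<) vs" and sub: "set vs \<subseteq> {Suc i..<n}"
    unfolding marked_NC_iff by blast+
  have "insert i (set (take s vs)) - {i} = set (take s vs)"
    using sub by (auto dest: in_set_takeD)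
  moreover have "sorted_list_of_set (set (take s vs)) = take s vs"
    using so by (simp add: sorted_list_of_set.idem_if_sorted_distinct strict_sorted_iff sorted_wrt_take)
  ultimately show ?thesis
    using block_of_close_block[OF vP, of s] by (simp add: open_block_def close_block_def Let_def)
qed

text \<open>An old mark is straddled by no block to begin with. If another block \<open>U\<close>
  straddled a new mark \<open>v\<close>, an element of the block of \<open>i\<close>, then
  \<open>i\<close>, an element of \<open>U\<close>, \<open>v\<close> and a further element of
  \<open>U\<close> would form a crossing.\<close>

lemma open_block_mem:
  assumes vP: "(vs, P) \<in> marked_NC n i" and i: "i < n" "i \<notin> set vs"
  shows "open_block i (vs, P) \<in> marked_NC n (Suc i)"
    and "length (fst (open_block i (vs, P))) \<ge> length vs"
    and "close_block i (length (fst (open_block i (vs, P))) - length vs) (open_block i (vs, P)) = (vs, P)"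
proof -
  from vP have so: "sorted_wrt (<) vs" and sub: "set vs \<subseteq> {i..<n}"
    and part: "partition_on ({i..<n} - set vs) P" and nc: "noncrossing P"
    and st: "\<And>U a b v. U \<in> P \<Longrightarrow> a \<in> U \<Longrightarrow> b \<in> U \<Longrightarrow> v \<in> set vs \<Longrightarrow> a < v \<Longrightarrow> v < b \<Longrightarrow> False"
    unfolding marked_NC_iff by blast+
  from part i obtain W where W: "W \<in> P" "i \<in> W"
    unfolding partition_on_def by (metis DiffI UnionE atLeastLessThan_iff order_refl)
  have disj: "U = V" if "U \<in> P" "V \<in> P" "a \<in> U" "a \<in> V" for U V a
    using part that unfolding partition_on_def disjoint_def by blast
  have the: "(THE W. W \<in> P \<and> i \<in> W) = W"
    by (rule the_equality) (use W disj in blast)+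
  have P: "i \<le> a" "a < n" "a \<notin> set vs" if "U \<in> P" "a \<in> U" for U a
    using partition_on_mem[OF part that] by auto
  have fin: "finite W" using P[OF W(1)] by (intro finite_subset[of W "{..<n}"]) auto
  let ?l = "sorted_list_of_set (W - {i})"
  have op: "open_block i (vs, P) = (?l @ vs, P - {W})"
    by (simp add: open_block_def the)
  have sl: "set ?l = W - {i}" using fin by simp
  have lt: "a < v" if "a \<in> W" "v \<in> set vs" for a v
  proof (rule ccontr)
    assume "\<not> a < v"
    moreover have "a \<noteq> v" using P(3)[OF W(1) that(1)] that(2) by blast
    moreover have "i < v" using that(2) sub i(2) by (metis atLeastLessThan_iff order_le_less subsetD)
    ultimately show False using st[OF W that] by auto
  qed
  have "sorted_wrt (<) (?l @ vs)"
    using so lt sl by (auto simp: sorted_wrt_append)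
  moreover have "set (?l @ vs) \<subseteq> {Suc i..<n}"
  proof -
    have "v \<noteq> i" if "v \<in> set vs" for v using that i by blast
    with sub have "set vs \<subseteq> {Suc i..<n}" by (auto simp: subset_iff Suc_le_eq order_less_le)
    moreover have "W - {i} \<subseteq> {Suc i..<n}" using P[OF W(1)] by (auto simp: Suc_le_eq order_less_le)
    ultimately show ?thesis using sl by simp
  qed
  moreover have "partition_on ({Suc i..<n} - set (?l @ vs)) (P - {W})"
  proof (rule partition_onI)
    have "\<Union> (P - {W}) = \<Union> P - W" using disj W(1) by blast
    also have "\<dots> = {i..<n} - set vs - W" using part by (simp add: partition_on_def)
    also have "\<dots> = {Suc i..<n} - set (?l @ vs)" 
    proof -
      have "{Suc i..<n} = {i..<n} - {i}" by auto
      then show ?thesis using sl W(2) by auto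
    qed
    finally show "\<Union> (P - {W}) = {Suc i..<n} - set (?l @ vs)" .
  qed (use part in \<open>auto simp: partition_on_def disjoint_def disjnt_def\<close>)
  moreover have "noncrossing (P - {W})" using nc unfolding noncrossing_def by blast
  moreover have "\<not> (a < v \<and> v < b)"
    if U: "U \<in> P - {W}" "a \<in> U" "b \<in> U" "v \<in> set (?l @ vs)" for U a b v
  proof
    assume *: "a < v \<and> v < b"
    have "v \<in> W"
      using U * st[of U a b v] sl by auto
    have "a \<noteq> i" using disj[of U W i] U W by blast
    then have "i < a" using P(1)[of U a] U by auto
    with nc \<open>v \<in> W\<close> W U * have "W = U"
      unfolding noncrossing_def by (metis DiffD1)
    with U show False by blast
  qed
  ultimately show "open_block i (vs, P) \<in> marked_NC n (Suc i)"
    unfolding op marked_NC_iff by blast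
  show "length (fst (open_block i (vs, P))) \<ge> length vs"
    by (simp add: op)
  show "close_block i (length (fst (open_block i (vs, P))) - length vs) (open_block i (vs, P)) = (vs, P)"
    using sl W by (auto simp: op close_block_def insert_absorb)
qed

lemma sorted_gap_notin:
  fixes w :: "nat list"
  assumes "sorted_wrt (<) (w @ [n])" "m < length w" "v \<in> {Suc (w ! m)..<(w @ [n]) ! Suc m}"
  shows "v \<notin> set w"
proof
  assume "v \<in> set w"
  then obtain k where k: "k < length w" "v = w ! k" by (auto simp: in_set_conv_nth)
  have w: "w ! a < w ! b" if "a < b" "b < length w" for a b
    using assms(1) that by (simp add: sorted_wrt_append sorted_wrt_nth_less)
  have "m < k" using assms(3) k w[of k m] assms(2) by (cases k m rule: linorder_cases) auto
  then have "(w @ [n]) ! Suc m \<le> v"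
    using k w[of "Suc m" k] by (cases "Suc m = k") (auto simp: nth_append)
  with assms(3) show False by simp
qed

text \<open>The first factor is the value to the left of the first mark. At \<open>i = 0\<close> the
  terms range between two extremes: without marks the term is \<open>kappa_part\<close>, and with
  every position marked it is the free Appell polynomial of the whole word.\<close>

definition marked_term :: "nat \<Rightarrow> ('a::ring_1 mat list \<Rightarrow> 'a mat) \<Rightarrow> 'a mat list \<Rightarrow> nat \<Rightarrow>
    nat list \<times> nat set set \<Rightarrow> 'a mat" where
  "marked_term d \<kappa> as i = (\<lambda>(vs, P). mult_ext d \<kappa> P as i (hd (vs @ [length as])) *
     appell d id \<kappa> (gap_args d \<kappa> P as vs))"

section \<open>Expansion of products into free Appell polynomials\<close>

context nc_prob_space
begin

text \<open>The last argument of \<open>\<kappa>\<close> still carries the gap up to the next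
  remaining mark \<open>h\<close>. Right linearity moves this factor out, and what results is the
  recursion of \<open>mult_ext\<close> for the enlarged partition on the interval from
  \<open>i\<close> to \<open>h\<close>.\<close>

lemma close_block_term:
  fixes as :: "'a mat list"
  assumes vP: "(vs, P) \<in> marked_NC (length as) (Suc i)" and i: "i < length as" and s: "s \<le> length vs"
    and car: "set as \<subseteq> carrier_mat d d"
    and \<kappa>: "\<And>cs. \<kappa> cs \<in> diag_scalars scale d"
      "\<And>cs c D. set cs \<subseteq> carrier_mat d d \<Longrightarrow> c \<in> carrier_mat d d \<Longrightarrow> D \<in> diag_scalars scale d \<Longrightarrow>
        \<kappa> (cs @ [c * D]) = \<kappa> (cs @ [c]) * D"
  shows "\<kappa> (take (Suc s) (gap_args d \<kappa> P as (i # vs))) * appell d id \<kappa> (drop s (gap_args d \<kappa> P as vs))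
    = marked_term d \<kappa> as i (close_block i s (vs, P))"
proof -
  let ?n = "length as" and ?w = "i # vs"
  define W where "W = insert i (set (take s vs))"
  define h where "h = hd (drop s vs @ [?n])"
  let ?P = "insert W P"
  note vP' = vP[unfolded marked_NC_iff]
  from vP' have so: "sorted_wrt (<) vs" and sub: "set vs \<subseteq> {Suc i..<?n}"
    and part: "partition_on ({Suc i..<?n} - set vs) P" by auto
  have sow: "sorted_wrt (<) (?w @ [?n])"
    using so sub i by (auto simp: sorted_wrt_append subset_iff Suc_le_eq)
  have P: "i \<notin> U" if "U \<in> P" for U
    using partition_on_mem[OF part that, of i] by auto
  have WM: "W \<subseteq> set ?w" by (auto simp: W_def dest: in_set_takeD)
  have MD: "mult_ext d \<kappa> Q as a b \<in> diag_scalars scale d" for Q a b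
    by (rule mult_ext_diag_scalars[OF \<kappa>(1)])
  note MC = diag_scalars_carrier[OF MD]
  have gap: "mult_ext d \<kappa> ?P as (Suc (?w ! m)) ((?w @ [?n]) ! Suc m)
      = mult_ext d \<kappa> P as (Suc (?w ! m)) ((?w @ [?n]) ! Suc m)" if "m < length ?w" for m
    by (rule mult_ext_insert_block) (use sorted_gap_notin[OF sow that] WM in blast)
  have ga: "gap_args d \<kappa> ?P as ?w = gap_args d \<kappa> P as ?w"
    unfolding gap_args_def by (rule map_cong) (simp_all only: gap set_upt atLeastLessThan_iff)
  then have ga': "gap_args d \<kappa> ?P as vs = gap_args d \<kappa> P as vs"
    by (simp add: gap_args_Cons)
  have hn: "(vs @ [?n]) ! s = h"
    using s by (cases "s = length vs") (auto simp: h_def nth_append hd_append hd_drop_conv_nth)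
  have lth: "a < h" if "a \<in> set (i # take s vs)" for a
  proof (cases "s = length vs")
    case True
    then show ?thesis using that sub i by (auto simp: h_def)
  next
    case False
    with s have "h \<in> set (drop s vs)" by (simp add: h_def)
    with that sub sorted_take_less_drop[OF so, of a s h] show ?thesis
      by (auto dest: in_set_dropD)
  qed
  have bl: "block_list ?P i h = i # take s vs"
  proof -
    have ge: "i \<le> a" if "a \<in> W" for a using that WM sub by auto
    have "{v \<in> {i..<h}. \<exists>U\<in>?P. i \<in> U \<and> v \<in> U} = {v \<in> {i..<h}. v \<in> W}"
      using P by (auto simp: W_def)
    also have "\<dots> = set (i # take s vs)"
      using lth ge unfolding W_def by auto
    finally show ?thesis
      unfolding block_list_def
    proof (simp only:)
      have "sorted_wrt (<) (i # take s vs)"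
        using so sub by (auto simp: sorted_wrt_take dest!: in_set_takeD)
      then show "sorted_list_of_set (set (i # take s vs)) = i # take s vs"
        by (simp only: sorted_list_of_set.idem_if_sorted_distinct strict_sorted_iff)
    qed
  qed
  have nb: "(i # take s vs) ! m = ?w ! m" if "m \<le> s" for m
    using that s by (cases m) auto
  have last: "last (i # take s vs) = ?w ! s"
  proof -
    have "last (i # take s vs) = (i # take s vs) ! s" using s by (subst last_conv_nth) auto
    then show ?thesis by (simp only: nb[OF order_refl])
  qed
  define l where "l = map (\<lambda>m. as ! (?w ! m) * mult_ext d \<kappa> ?P as (Suc (?w ! m)) ((?w @ [?n]) ! Suc m)) [0..<s]"
  have "map (\<lambda>m. as ! ((i # take s vs) ! m) *
      mult_ext d \<kappa> ?P as (Suc ((i # take s vs) ! m)) ((i # take s vs) ! Suc m)) [0..<length (i # take s vs) - 1] = l"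
    unfolding l_def
  proof (rule map_cong)
    fix m assume "m \<in> set [0..<s]"
    then have m: "m < s" by simp
    then have "(?w @ [?n]) ! Suc m = ?w ! Suc m" using s by (simp add: nth_append)
    with m show "as ! ((i # take s vs) ! m) *
      mult_ext d \<kappa> ?P as (Suc ((i # take s vs) ! m)) ((i # take s vs) ! Suc m) =
      as ! (?w ! m) * mult_ext d \<kappa> ?P as (Suc (?w ! m)) ((?w @ [?n]) ! Suc m)"
      by (simp only: nb Suc_le_eq less_imp_le)
  qed (use s in simp)
  then have me: "mult_ext d \<kappa> ?P as i h =
      \<kappa> (l @ [as ! (?w ! s)]) * mult_ext d \<kappa> ?P as (Suc (?w ! s)) h"
    by (subst mult_ext.simps) (simp only: bl last list.distinct(2) if_False)
  have "take (Suc s) (gap_args d \<kappa> ?P as ?w) =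
      l @ [as ! (?w ! s) * mult_ext d \<kappa> ?P as (Suc (?w ! s)) h]"
  proof -
    have "take (Suc s) [0..<length ?w] = [0..<s] @ [s]"
      using s by (subst take_upt) (auto simp del: upt_Suc simp: upt_Suc_append)
    then show ?thesis
      unfolding gap_args_def l_def take_map using hn by simp
  qed
  moreover have asw: "as ! (?w ! m) \<in> carrier_mat d d" if "m \<le> s" for m
  proof -
    have "?w ! m \<in> set ?w" using that s by (intro nth_mem) simp
    with sub i have "?w ! m < ?n" by auto
    with car show ?thesis by (auto simp: subset_iff)
  qed
  moreover have "set l \<subseteq> carrier_mat d d"
    unfolding l_def using asw MC by (auto intro!: mult_carrier_mat[of _ d d])
  ultimately have "\<kappa> (take (Suc s) (gap_args d \<kappa> ?P as ?w)) = mult_ext d \<kappa> ?P as i h"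
    using \<kappa>(2)[OF _ _ MD] by (simp add: me)
  then show ?thesis
    unfolding ga marked_term_def close_block_def
    by (simp add: drop_gap_args ga'[symmetric] W_def[symmetric] h_def[symmetric])
qed

lemma gap_args_carrier:
  assumes "set vs \<subseteq> {..<length as}" "set as \<subseteq> carrier_mat d d" "\<And>cs. \<kappa> cs \<in> diag_scalars scale d"
  shows "set (gap_args d \<kappa> P as vs) \<subseteq> carrier_mat d d"
  using assms diag_scalars_carrier[OF mult_ext_diag_scalars[of \<kappa> d, OF assms(3)]]
  by (auto simp: gap_args_def subset_iff intro!: mult_carrier_mat[of _ d d])

lemma mult_appell:
  fixes as :: "'a mat list"
  assumes "set (a # as) \<subseteq> carrier_mat d d"
  shows "a * appell d id \<kappa> as = appell d id \<kappa> (a # as)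
     + matsum d (\<lambda>s. \<kappa> (take (Suc s) (a # as)) * appell d id \<kappa> (drop s as)) {..length as}"
proof -
  have "a * appell d id \<kappa> as \<in> carrier_mat d d"
    using assms by (intro mult_carrier_mat[of _ d d] appell_carrier) auto
  then show ?thesis
    by (intro eq_matI) (auto simp: matsum_def)
qed

text \<open>Induction from the right end. Multiplying a term by the letter at \<open>i\<close> and
  applying the Appell recursion produces one term in which \<open>i\<close> is marked, and for each
  \<open>s\<close> one term in which \<open>i\<close> closes a block with the first \<open>s\<close>
  marks. Every marked partition starting at \<open>i\<close> arises exactly once.\<close>

lemma mat_list_prod_marked:
  fixes as :: "'a mat list"
  assumes car: "set as \<subseteq> carrier_mat d d"
    and \<kappa>: "\<And>cs. \<kappa> cs \<in> diag_scalars scale d"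
      "\<And>cs c D. set cs \<subseteq> carrier_mat d d \<Longrightarrow> c \<in> carrier_mat d d \<Longrightarrow> D \<in> diag_scalars scale d \<Longrightarrow>
        \<kappa> (cs @ [c * D]) = \<kappa> (cs @ [c]) * D"
    and i: "i \<le> length as"
  shows "mat_list_prod d (drop i as) = matsum d (marked_term d \<kappa> as i) (marked_NC (length as) i)"
  using i
proof (induction i rule: inc_induct)
  case base
  show ?case
    by (rule eq_matI)
      (auto simp: mat_list_prod_def matsum_def marked_NC_end marked_term_def gap_args_Nil mult_ext_empty)
next
  case (step i)
  let ?n = "length as" and ?t = "marked_term d \<kappa> as"
  let ?M = "marked_NC ?n"
  note MC = diag_scalars_carrier[OF mult_ext_diag_scalars[of \<kappa> d, OF \<kappa>(1)]]
  have ai: "as ! i \<in> carrier_mat d d" using step car by (auto simp: subset_iff)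
  have gc: "set (gap_args d \<kappa> P as vs) \<subseteq> carrier_mat d d" if "(vs, P) \<in> ?M j" for vs P j
    using that by (intro gap_args_carrier car \<kappa>(1)) (auto simp: marked_NC_iff)
  have tC: "?t j p \<in> carrier_mat d d" if "p \<in> ?M j" for j p
    using that gc MC by (cases p) (auto simp: marked_term_def intro!: mult_carrier_mat[of _ d d] appell_carrier)
  have expand: "as ! i * ?t (Suc i) (vs, P) = ?t i (i # vs, P)
      + matsum d (\<lambda>s. ?t i (close_block i s (vs, P))) {..length vs}"
    if vP: "(vs, P) \<in> ?M (Suc i)" for vs P
  proof -
    let ?g = "gap_args d \<kappa> P as" and ?c = "mult_ext d \<kappa> P as (Suc i) (hd (vs @ [?n]))"
    have gi: "?g (i # vs) = (as ! i * ?c) # ?g vs" by (rule gap_args_Cons)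
    have gic: "set (?g (i # vs)) \<subseteq> carrier_mat d d"
      using vP step by (intro gc[of _ _ i]) (simp add: marked_NC_mark)
    have "as ! i * ?t (Suc i) (vs, P) = (as ! i * ?c) * appell d id \<kappa> (?g vs)"
      unfolding marked_term_def case_prod_conv by (rule assoc_mult_mat[OF ai MC appell_carrier, symmetric])
    also have "\<dots> = appell d id \<kappa> (?g (i # vs))
        + matsum d (\<lambda>s. \<kappa> (take (Suc s) (?g (i # vs))) * appell d id \<kappa> (drop s (?g vs))) {..length (?g vs)}"
      using gic unfolding gi by (rule mult_appell)
    also have "appell d id \<kappa> (?g (i # vs)) = ?t i (i # vs, P)"
      by (simp add: marked_term_def mult_ext_empty left_mult_one_mat[OF appell_carrier])
    also have "matsum d (\<lambda>s. \<kappa> (take (Suc s) (?g (i # vs))) * appell d id \<kappa> (drop s (?g vs))) {..length (?g vs)}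
        = matsum d (\<lambda>s. ?t i (close_block i s (vs, P))) {..length vs}"
      using close_block_term[OF vP step(2) _ car \<kappa>] unfolding length_gap_args
      by (intro matsum_cong) (simp only: atMost_iff)
    finally show ?thesis .
  qed
  have "mat_list_prod d (drop i as) = as ! i * mat_list_prod d (drop (Suc i) as)"
    using step by (simp add: mat_list_prod_def flip: Cons_nth_drop_Suc)
  also have "\<dots> = matsum d (\<lambda>p. as ! i * ?t (Suc i) p) (?M (Suc i))"
    unfolding step.IH by (rule mult_matsum[OF ai tC])
  also have "\<dots> = matsum d (?t i) (?M i)"
  proof (rule eq_matI)
    fix r c assume "r < dim_row (matsum d (?t i) (?M i))" "c < dim_col (matsum d (?t i) (?M i))"
    then have rc: "r < d" "c < d" by (auto simp: matsum_def)
    let ?f = "\<lambda>q. ?t i q $$ (r, c)"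
    \<comment> \<open>The first class comes from marking \<open>i\<close>, the second from closing a
      block at \<open>i\<close>; \<open>tl\<close> and \<open>open_block\<close> provide the inverse
      maps.\<close>
    let ?A = "{q \<in> ?M i. i \<in> set (fst q)}" and ?B = "{q \<in> ?M i. i \<notin> set (fst q)}"
    have "(\<Sum>p\<in>?M (Suc i). (as ! i * ?t (Suc i) p) $$ (r, c)) =
        (\<Sum>p\<in>?M (Suc i). ?f (i # fst p, snd p) + (\<Sum>s\<le>length (fst p). ?f (close_block i s p)))"
    proof (rule sum.cong[OF refl])
      fix p assume p: "p \<in> ?M (Suc i)"
      obtain vs P where vP: "p = (vs, P)" by (cases p)
      from expand[of vs P] p vP rc
      show "(as ! i * ?t (Suc i) p) $$ (r, c) =
          ?f (i # fst p, snd p) + (\<Sum>s\<le>length (fst p). ?f (close_block i s p))"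
        by (simp add: matsum_def)
    qed
    also have "\<dots> = (\<Sum>p\<in>?M (Suc i). ?f (i # fst p, snd p)) +
        (\<Sum>p\<in>?M (Suc i). \<Sum>s\<le>length (fst p). ?f (close_block i s p))"
      by (rule sum.distrib)
    also have "(\<Sum>p\<in>?M (Suc i). ?f (i # fst p, snd p)) = sum ?f ?A"
    proof (rule sum.reindex_bij_witness[where i = "\<lambda>q. (tl (fst q), snd q)" and j = "\<lambda>p. (i # fst p, snd p)"])
      fix q assume "q \<in> ?A"
      then obtain vs P where q: "q = (vs, P)" "(vs, P) \<in> ?M i" "i \<in> set vs" by (cases q) auto
      \<comment> \<open>\<open>i\<close> is the smallest possible position, so once marked it heads
        the increasing list.\<close>
      have "vs = i # tl vs"
      proof (cases vs)
        case (Cons v ws)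
        then show ?thesis using q(2,3) by (auto simp: marked_NC_iff)
      qed (use q in simp)
      then show "(i # fst (tl (fst q), snd q), snd (tl (fst q), snd q)) = q"
        by (simp add: q)
      show "(tl (fst q), snd q) \<in> ?M (Suc i)"
        using q(2) step(2) \<open>vs = i # tl vs\<close> marked_NC_mark[of i ?n "tl vs" P] by (simp add: q(1))
    qed (use step in \<open>auto simp: marked_NC_mark\<close>)
    also have "(\<Sum>p\<in>?M (Suc i). \<Sum>s\<le>length (fst p). ?f (close_block i s p)) =
        (\<Sum>(p, s)\<in>Sigma (?M (Suc i)) (\<lambda>p. {..length (fst p)}). ?f (close_block i s p))"
      by (intro sum.Sigma ballI finite_marked_NC) simp
    also have "\<dots> = sum ?f ?B"
    proof (rule sum.reindex_bij_witness[where
          i = "\<lambda>q. (open_block i q, length (fst (open_block i q)) - length (fst q))"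
          and j = "\<lambda>(p, s). close_block i s p"])
      fix q assume "q \<in> ?B"
      then obtain vs P where q: "q = (vs, P)" "(vs, P) \<in> ?M i" "i \<notin> set vs" by (cases q) auto
      note op = open_block_mem[OF q(2) step(2) q(3)]
      from op show "(case (open_block i q, length (fst (open_block i q)) - length (fst q)) of
          (p, s) \<Rightarrow> close_block i s p) = q"
        by (simp add: q(1))
      from op show "(open_block i q, length (fst (open_block i q)) - length (fst q))
          \<in> Sigma (?M (Suc i)) (\<lambda>p. {..length (fst p)})"
        by (simp add: q(1))
    next
      fix ps assume "ps \<in> Sigma (?M (Suc i)) (\<lambda>p. {..length (fst p)})"
      then obtain vs P s where ps: "ps = ((vs, P), s)" "(vs, P) \<in> ?M (Suc i)" "s \<le> length vs"
        by (cases ps) auto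
      have "length (fst (close_block i s (vs, P))) = length vs - s" by (simp add: close_block_def)
      then show "(open_block i (case ps of (p, s) \<Rightarrow> close_block i s p),
          length (fst (open_block i (case ps of (p, s) \<Rightarrow> close_block i s p))) -
          length (fst (case ps of (p, s) \<Rightarrow> close_block i s p))) = ps"
        using ps(3) by (simp add: ps(1) open_close_block[OF ps(2)])
      show "(case ps of (p, s) \<Rightarrow> close_block i s p) \<in> ?B"
        using close_block_mem[OF ps(2) step(2), of s] by (simp add: ps(1))
      show "?f (case ps of (p, s) \<Rightarrow> close_block i s p) = (case ps of (p, s) \<Rightarrow> ?f (close_block i s p))"
        by (simp add: ps(1))
    qed
    also have "sum ?f ?A + sum ?f ?B = sum ?f (?M i)"
      by (subst sum.union_disjoint[symmetric]) (auto simp: finite_marked_NC intro!: sum.cong)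
    finally show "matsum d (\<lambda>p. as ! i * ?t (Suc i) p) (?M (Suc i)) $$ (r, c) = matsum d (?t i) (?M i) $$ (r, c)"
      using rc by (simp add: matsum_def)
  qed (auto simp: matsum_def)
  finally show ?case .
qed

text \<open>Induction on the length, applied to the expansion at \<open>i = 0\<close>. A term with
  some but not all positions marked contains the Appell polynomial of a shorter word and has
  expectation zero. The terms without marks already sum to the moment by the moment-cumulant
  formula, so nothing is left for the fully marked term, which is the polynomial of
  \<open>as\<close> itself.\<close>

theorem cond_exp_appell:
  fixes as :: "'a mat list"
  shows "as \<noteq> [] \<Longrightarrow> set as \<subseteq> carrier_mat d d \<Longrightarrow>
    cond_exp scale \<tau> d (appell d id (free_cumulant scale \<tau> d) as) = 0\<^sub>m d d"
proof (induction as rule: length_induct)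
  case (1 as)
  let ?n = "length as" and ?K = "free_cumulant scale \<tau> d" and ?E = "cond_exp scale \<tau> d"
  let ?t = "marked_term d ?K as 0" and ?M = "marked_NC (length as) 0"
  note ne = 1(2) and car = 1(3)
  have MD: "mult_ext d ?K P as i j \<in> diag_scalars scale d" for P i j
    by (rule mult_ext_diag_scalars[OF free_cumulant_diag_scalars])
  have gc: "set (gap_args d ?K P as vs) \<subseteq> carrier_mat d d" if "(vs, P) \<in> ?M" for vs P
    using that by (intro gap_args_carrier car free_cumulant_diag_scalars) (auto simp: marked_NC_iff)
  have Et: "?E (?t (vs, P)) = mult_ext d ?K P as 0 (hd (vs @ [?n])) * ?E (appell d id ?K (gap_args d ?K P as vs))"
    if "(vs, P) \<in> ?M" for vs P
    using cond_exp_mult_left[OF MD appell_carrier] by (simp add: marked_term_def)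
  have full: "?t ([0..<?n], {}) = appell d id ?K as"
  proof -
    have "gap_args d ?K {} as [0..<?n] = as"
    proof (rule nth_equalityI)
      fix m assume "m < length (gap_args d ?K {} as [0..<?n])"
      then have m: "m < ?n" by simp
      then have "([0..<?n] @ [?n]) ! Suc m = Suc m" by (cases "Suc m = ?n") (auto simp: nth_append)
      moreover have "as ! m \<in> carrier_mat d d" using m car by (auto simp: subset_iff)
      ultimately show "gap_args d ?K {} as [0..<?n] ! m = as ! m"
        using m by (simp add: gap_args_def mult_ext_empty)
    qed simp
    moreover have "hd ([0..<?n] @ [?n]) = 0" using ne by (simp add: hd_append)
    ultimately show ?thesis
      by (simp add: marked_term_def mult_ext_empty left_mult_one_mat[OF appell_carrier])
  qed
  have fullM: "([0..<?n], {}) \<in> ?M"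
    by (auto simp: marked_NC_iff noncrossing_def partition_on_def)
  have zero: "?E (?t (vs, P)) = 0\<^sub>m d d"
    if vP: "(vs, P) \<in> ?M" "vs \<noteq> []" "(vs, P) \<noteq> ([0..<?n], {})" for vs P
  proof -
    from vP(1) have vs: "sorted_wrt (<) vs" "set vs \<subseteq> {0..<?n}" "partition_on ({0..<?n} - set vs) P"
      by (auto simp: marked_NC_iff)
    have "length vs = card (set vs)" using vs(1) by (simp add: distinct_card strict_sorted_iff)
    moreover have "set vs \<noteq> {0..<?n}"
    proof
      assume *: "set vs = {0..<?n}"
      then have "vs = [0..<?n]"
        using vs(1) by (metis sorted_list_of_set.idem_if_sorted_distinct sorted_list_of_set_range strict_sorted_iff)
      with * vs(3) vP(3) show False by (auto simp: partition_on_def)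
    qed
    then have "card (set vs) < card {0..<?n}"
      using vs(2) by (intro psubset_card_mono) auto
    ultimately have "length (gap_args d ?K P as vs) < ?n" by simp
    moreover have "gap_args d ?K P as vs \<noteq> []" using vP(2) by (simp flip: length_greater_0_conv)
    ultimately have "?E (appell d id ?K (gap_args d ?K P as vs)) = 0\<^sub>m d d"
      using 1(1) gc[OF vP(1)] by blast
    then show ?thesis
      using Et[OF vP(1)] diag_scalars_carrier[OF MD] by (simp add: right_mult_zero_mat[of _ d d])
  qed
  have nil: "?E (?t ([], P)) = kappa_part d ?K P as" if "P \<in> NC ?n" for P
    using that cond_exp_diag[OF MD] diag_scalars_carrier[OF MD]
    by (simp add: marked_term_def gap_args_Nil kappa_part_def right_mult_one_mat[of _ d d])
  have "mat_list_prod d as = matsum d ?t ?M"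
    using mat_list_prod_marked[OF car free_cumulant_diag_scalars free_cumulant_mult_last, of 0] by simp
  then have "?E (mat_list_prod d as) = matsum d (\<lambda>p. ?E (?t p)) ?M"
    using cond_exp_matsum by simp
  then have eq: "matsum d (\<lambda>p. ?E (?t p)) ?M = matsum d (\<lambda>P. kappa_part d ?K P as) (NC ?n)"
    using moment_cumulant[OF ne car, of scale \<tau>] by simp
  show ?case
  proof (rule eq_matI)
    fix r c assume "r < dim_row (0\<^sub>m d d :: 'a mat)" "c < dim_col (0\<^sub>m d d :: 'a mat)"
    then have rc: "r < d" "c < d" by auto
    let ?f = "\<lambda>p. ?E (?t p) $$ (r, c)"
    let ?N = "Pair [] ` NC ?n"
    have "(\<Sum>P\<in>NC ?n. kappa_part d ?K P as $$ (r, c)) = sum ?f ?M"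
      using arg_cong[OF eq, of "\<lambda>A. A $$ (r, c)"] rc by (simp add: matsum_def)
    also have "\<dots> = sum ?f (insert ([0..<?n], {}) ?N)"
    proof (rule sum.mono_neutral_right[OF finite_marked_NC])
      show "insert ([0..<?n], {}) ?N \<subseteq> ?M"
        using fullM by (auto simp: marked_NC_Nil)
      show "\<forall>p\<in>?M - insert ([0..<?n], {}) ?N. ?f p = 0"
      proof
        fix p assume "p \<in> ?M - insert ([0..<?n], {}) ?N"
        moreover obtain vs P where p: "p = (vs, P)" by (cases p)
        ultimately have vP: "(vs, P) \<in> ?M" "(vs, P) \<noteq> ([0..<?n], {})" "(vs, P) \<notin> ?N" by auto
        then have "vs \<noteq> []" using marked_NC_Nil[of P ?n] by blast
        from zero[OF vP(1) this vP(2)] rc show "?f p = 0" by (simp add: p)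
      qed
    qed
    also have "\<dots> = ?f ([0..<?n], {}) + sum ?f ?N"
      using ne by (intro sum.insert) (auto simp: finite_NC)
    also have "sum ?f ?N = (\<Sum>P\<in>NC ?n. ?f ([], P))"
      by (subst sum.reindex) (auto simp: inj_on_def)
    also have "\<dots> = (\<Sum>P\<in>NC ?n. kappa_part d ?K P as $$ (r, c))"
      by (rule sum.cong) (auto simp: nil)
    finally show "?E (appell d id ?K as) $$ (r, c) = 0\<^sub>m d d $$ (r, c)"
      using rc by (simp add: full)
  qed (use carrier_matD[OF cond_exp_carrier] in auto)
qed

end

section \<open>Freeness from the scalar matrices\<close>

definition entry_mat :: "nat \<Rightarrow> nat \<Rightarrow> nat \<Rightarrow> 'a::zero \<Rightarrow> 'a mat" where
  "entry_mat d i j b = mat d d (\<lambda>p. if p = (i, j) then b else 0)"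

lemma entry_mat_carrier: "entry_mat d i j b \<in> carrier_mat d d"
  by (simp add: entry_mat_def)

lemma entry_mat_index:
  "r < d \<Longrightarrow> c < d \<Longrightarrow> entry_mat d i j b $$ (r, c) = (if r = i \<and> c = j then b else 0)"
  by (simp add: entry_mat_def)

locale free_from_scalars = nc_prob_space scale \<tau>
  for scale :: "complex \<Rightarrow> 'a::ring_1 \<Rightarrow> 'a" and \<tau> +
  fixes d :: nat and X :: "'a mat"
  assumes X_carrier: "X \<in> carrier_mat d d"
    and X_free: "free_from_scalar_mats scale \<tau> d X"
begin

lemma entry_mat_mult:
  assumes "i < d" "j < d" "k < d" "l < d"
  shows "entry_mat d i j (b :: 'a) * entry_mat d k l c = (if j = k then entry_mat d i l (b * c) else 0\<^sub>m d d)"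
proof (rule eq_matI)
  fix r s assume "r < dim_row (if j = k then entry_mat d i l (b * c) else 0\<^sub>m d d)"
    "s < dim_col (if j = k then entry_mat d i l (b * c) else 0\<^sub>m d d)"
  then have rs: "r < d" "s < d" by (auto simp: entry_mat_def split: if_splits)
  have "(entry_mat d i j b * entry_mat d k l c) $$ (r, s)
      = (\<Sum>m<d. (if r = i \<and> m = j then b else 0) * (if m = k \<and> s = l then c else 0))"
    using rs by (simp add: mult_mat_index[OF entry_mat_carrier entry_mat_carrier] entry_mat_index)
  also have "\<dots> = (\<Sum>m\<in>{j}. (if r = i \<and> m = j then b else 0) * (if m = k \<and> s = l then c else 0))"
    using assms by (intro sum.mono_neutral_right) auto
  finally show "(entry_mat d i j b * entry_mat d k l c) $$ (r, s) =
      (if j = k then entry_mat d i l (b * c) else 0\<^sub>m d d) $$ (r, s)"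
    using rs by (auto simp: entry_mat_index)
qed (auto simp: entry_mat_def)

lemma entry_mat_diag: "entry_mat d i i (scale c 1) \<in> diag_scalars scale d"
  unfolding diag_scalars_iff using scale_zero_left[of 1]
  by (auto simp: entry_mat_def intro: exI[of _ 0])

lemma alg_carrier: "S \<subseteq> carrier_mat d d \<Longrightarrow> A \<in> alg_over_diag scale d S \<Longrightarrow> A \<in> carrier_mat d d"
  by (rule alg_over_diag.induct[of A scale d S])
    (auto dest: diag_scalars_carrier)

text \<open>The corner at \<open>(i, j)\<close> of the algebra generated by \<open>X\<close> and the
  diagonal scalars. Since the diagonal matrix units belong to that algebra, single entries of its
  elements can be isolated by multiplying with them on both sides; \<open>corner_X\<close> does so
  for \<open>X\<close>.\<close>

definition corner :: "nat \<Rightarrow> nat \<Rightarrow> 'a set" where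
  "corner i j = {b. entry_mat d i j b \<in> alg_over_diag scale d {X}}"

lemma corner_add: "b \<in> corner i j \<Longrightarrow> c \<in> corner i j \<Longrightarrow> b + c \<in> corner i j"
proof -
  assume "b \<in> corner i j" "c \<in> corner i j"
  then have "entry_mat d i j b + entry_mat d i j c \<in> alg_over_diag scale d {X}"
    unfolding corner_def by (auto intro: alg_over_diag.add)
  also have "entry_mat d i j b + entry_mat d i j c = entry_mat d i j (b + c)"
    by (rule eq_matI) (auto simp: entry_mat_def)
  finally show ?thesis by (simp add: corner_def)
qed

lemma corner_scale: "b \<in> corner i j \<Longrightarrow> scale c b \<in> corner i j"
proof -
  assume "b \<in> corner i j"
  then have "map_mat (scale c) (entry_mat d i j b) \<in> alg_over_diag scale d {X}"
    unfolding corner_def by (auto intro: alg_over_diag.smult)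
  also have "map_mat (scale c) (entry_mat d i j b) = entry_mat d i j (scale c b)"
    by (rule eq_matI) (auto simp: entry_mat_def)
  finally show ?thesis by (simp add: corner_def)
qed

lemma corner_diff: "b \<in> corner i j \<Longrightarrow> c \<in> corner i j \<Longrightarrow> b - c \<in> corner i j"
  using corner_add[of b i j "scale (- 1) c"] corner_scale[of c i j "- 1"] by simp

lemma corner_mult:
  assumes "i < d" "j < d" "k < d" "b \<in> corner i j" "c \<in> corner j k"
  shows "b * c \<in> corner i k"
proof -
  have "entry_mat d i j b * entry_mat d j k c \<in> alg_over_diag scale d {X}"
    using assms(4,5) unfolding corner_def by (auto intro: alg_over_diag.mult)
  then show ?thesis using assms(1-3) by (simp add: entry_mat_mult corner_def)
qed

lemma corner_one: "1 \<in> corner i i"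
  using entry_mat_diag[of i 1] by (simp add: corner_def alg_over_diag.diag)

lemma corner_X:
  assumes "i < d" "j < d"
  shows "X $$ (i, j) \<in> corner i j"
proof -
  have "entry_mat d i i (scale 1 1) * X * entry_mat d j j (scale 1 1) \<in> alg_over_diag scale d {X}"
    by (intro alg_over_diag.mult alg_over_diag.diag entry_mat_diag alg_over_diag.gen) simp
  also have "entry_mat d i i (scale 1 1) * X * entry_mat d j j (scale 1 1) = entry_mat d i j (X $$ (i, j))"
  proof (rule eq_matI)
    have EX: "entry_mat d i i (scale 1 1) * X \<in> carrier_mat d d"
      using X_carrier entry_mat_carrier by (rule mult_carrier_mat[rotated])
    fix r c assume "r < dim_row (entry_mat d i j (X $$ (i, j)))" "c < dim_col (entry_mat d i j (X $$ (i, j)))"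
    then have rc: "r < d" "c < d" by (auto simp: entry_mat_def)
    then show "(entry_mat d i i (scale 1 1) * X * entry_mat d j j (scale 1 1)) $$ (r, c) =
        entry_mat d i j (X $$ (i, j)) $$ (r, c)"
      unfolding mult_diag_index[OF entry_mat_diag EX rc] diag_mult_index[OF entry_mat_diag X_carrier rc]
      by (auto simp: entry_mat_index)
  qed (auto simp: entry_mat_def)
  finally show ?thesis by (simp add: corner_def)
qed

section \<open>Alternating words in the algebra of X and the scalar matrices\<close>

definition free_word :: "bool list \<Rightarrow> 'a mat list \<Rightarrow> bool" where
  "free_word is xs \<longleftrightarrow> length xs = length is \<and>
     (\<forall>j<length is. xs ! j \<in> (if is ! j then alg_over_diag scale d {X} else scalar_mats scale d) \<and>
        cond_exp scale \<tau> d (xs ! j) = 0\<^sub>m d d) \<and>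
     (\<forall>j. Suc j < length is \<longrightarrow> is ! j \<noteq> is ! Suc j)"

lemma cond_exp_free_word:
  assumes "free_word is xs" "is \<noteq> []"
  shows "cond_exp scale \<tau> d (mat_list_prod d xs) = 0\<^sub>m d d"
  using X_free[unfolded free_from_scalar_mats_def free_algs_def, rule_format, of "is" xs] assms
  by (auto simp: free_word_def)

lemma free_word_carrier: "free_word is xs \<Longrightarrow> set xs \<subseteq> carrier_mat d d"
  using alg_carrier[of "{X}"] X_carrier
  by (fastforce simp: free_word_def scalar_mats_def in_set_conv_nth split: if_splits)

lemma free_word_snoc:
  assumes "free_word is xs" "is = [] \<or> last is \<noteq> b" "cond_exp scale \<tau> d x = 0\<^sub>m d d"
    "x \<in> (if b then alg_over_diag scale d {X} else scalar_mats scale d)"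
  shows "free_word (is @ [b]) (xs @ [x])"
proof -
  have "(is @ [b]) ! j \<noteq> (is @ [b]) ! Suc j" if "Suc j < length (is @ [b])" for j
  proof (cases "Suc j < length is")
    case True
    with assms(1) show ?thesis by (simp add: free_word_def nth_append)
  next
    case False
    with that have j: "length is = Suc j" by simp
    then have "last is = is ! j" by (cases "is" rule: rev_cases) (auto simp: nth_append)
    moreover have "is \<noteq> []" using j by auto
    ultimately show ?thesis using assms(2) j by (simp add: nth_append)
  qed
  with assms show ?thesis
    by (auto simp: free_word_def nth_append less_Suc_eq)
qed

lemma cond_exp_entry_mat: "i \<noteq> j \<or> \<tau> b = 0 \<Longrightarrow> cond_exp scale \<tau> d (entry_mat d i j b) = 0\<^sub>m d d"
  by (rule eq_matI) (auto simp: cond_exp_def mat_diag_def entry_mat_def)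

lemma entry_mat_scalar: "entry_mat d i j 1 \<in> scalar_mats scale d"
proof -
  have "entry_mat d i j 1 = map_mat (\<lambda>c. scale c 1) (entry_mat d i j 1)"
    by (rule eq_matI) (auto simp: entry_mat_def)
  then show ?thesis unfolding scalar_mats_def using entry_mat_carrier by blast
qed

lemma free_word_Nil: "free_word [] []"
  by (simp add: free_word_def)

text \<open>The conditional expectation only sees diagonal entries. If \<open>i \<noteq> j\<close>,
  appending the matrix unit at \<open>(j, i)\<close>, which is centered, moves \<open>w\<close> to
  the diagonal; the word stays alternating because it ends in the algebra of
  \<open>X\<close>.\<close>

lemma tau_free_word:
  assumes "free_word is xs" "is \<noteq> []" "last is" "i < d" "j < d"
    and w: "mat_list_prod d xs = entry_mat d i j w"
  shows "\<tau> w = 0"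
proof -
  have *: "\<tau> w = 0" if "cond_exp scale \<tau> d (entry_mat d i i w) = 0\<^sub>m d d"
    using arg_cong[OF that, of "\<lambda>A. A $$ (i, i)"] assms(4)
    by (simp add: cond_exp_index entry_mat_index)
  show ?thesis
  proof (cases "i = j")
    case True
    with cond_exp_free_word[OF assms(1,2)] w show ?thesis by (intro *) simp
  next
    case False
    let ?e = "entry_mat d j i 1"
    have "free_word (is @ [False]) (xs @ [?e])"
      using assms False by (intro free_word_snoc cond_exp_entry_mat) (auto simp: entry_mat_scalar)
    then have "cond_exp scale \<tau> d (mat_list_prod d (xs @ [?e])) = 0\<^sub>m d d"
      by (rule cond_exp_free_word) simp
    also have "mat_list_prod d (xs @ [?e]) = entry_mat d i i w"
      using free_word_carrier[OF assms(1)] entry_mat_carrier[of d j i "1::'a"] assms(4,5)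
      by (simp add: mat_list_prod_append w)
        (simp add: mat_list_prod_def right_mult_one_mat[OF entry_mat_carrier] entry_mat_mult)
    finally show ?thesis by (rule *)
  qed
qed

text \<open>An off-diagonal corner element is centered as a matrix for trivial reasons, yet freeness
  applied to it yields the nontrivial fact that \<open>\<tau>\<close> kills the entry
  itself.\<close>

lemma tau_corner:
  assumes "b \<in> corner i j" "i < d" "j < d" "i \<noteq> j"
  shows "\<tau> b = 0"
proof (rule tau_free_word[of "[True]" "[entry_mat d i j b]"])
  have "free_word ([] @ [True]) ([] @ [entry_mat d i j b])"
    using assms by (intro free_word_snoc free_word_Nil cond_exp_entry_mat) (auto simp: corner_def)
  then show "free_word [True] [entry_mat d i j b]" by simp
qed (use assms in \<open>auto simp: mat_list_prod_def right_mult_one_mat[OF entry_mat_carrier]\<close>)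

inductive reduced :: "nat \<Rightarrow> nat \<Rightarrow> 'a \<Rightarrow> bool" where
  block: "i < d \<Longrightarrow> j < d \<Longrightarrow> b \<in> corner i j \<Longrightarrow> \<tau> b = 0 \<Longrightarrow> reduced i j b"
| snoc: "reduced i j w \<Longrightarrow> k < d \<Longrightarrow> l < d \<Longrightarrow> b \<in> corner k l \<Longrightarrow> \<tau> b = 0 \<Longrightarrow> j \<noteq> k \<Longrightarrow>
    reduced i l (w * b)"

text \<open>The matrix unit inserted between two factors sits at \<open>(j, k)\<close>. The
  constraint \<open>j \<noteq> k\<close> makes it centered, so the factors and the units together
  form a word to which freeness applies.\<close>

lemma reduced_free_word:
  assumes "reduced i j w"
  shows "i < d \<and> j < d \<and> (\<exists>is xs. free_word is xs \<and> is \<noteq> [] \<and> last is \<and> mat_list_prod d xs = entry_mat d i j w)"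
  using assms
proof induction
  case (block i j b)
  have "free_word ([] @ [True]) ([] @ [entry_mat d i j b])"
    using block by (intro free_word_snoc free_word_Nil cond_exp_entry_mat) (auto simp: corner_def)
  then show ?case
    using block by (intro conjI exI[of _ "[True]"] exI[of _ "[entry_mat d i j b]"])
      (auto simp: mat_list_prod_def right_mult_one_mat[OF entry_mat_carrier])
next
  case (snoc i j w k l b)
  then obtain "is" xs where w: "free_word is xs" "is \<noteq> []" "last is" "mat_list_prod d xs = entry_mat d i j w"
    and ij: "i < d" "j < d" by blast
  let ?e = "entry_mat d j k 1" and ?b = "entry_mat d k l b"
  have "free_word ((is @ [False]) @ [True]) ((xs @ [?e]) @ [?b])"
    using w snoc by (intro free_word_snoc cond_exp_entry_mat) (auto simp: corner_def entry_mat_scalar)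
  moreover have "mat_list_prod d ((xs @ [?e]) @ [?b]) = entry_mat d i l (w * b)"
    using free_word_carrier[OF w(1)] entry_mat_carrier[of d _ _ "1 :: 'a"] entry_mat_carrier[of d _ _ b] ij snoc.hyps
    by (simp add: mat_list_prod_append w)
      (simp add: mat_list_prod_def right_mult_one_mat[OF entry_mat_carrier] entry_mat_mult)
  ultimately show ?case using ij snoc.hyps by (metis last_snoc snoc_eq_iff_butlast)
qed

lemma tau_reduced: "reduced i j w \<Longrightarrow> \<tau> w = 0"
  using reduced_free_word tau_free_word by blast

lemma reduced_append:
  assumes "reduced k l v" "reduced i j w" "j \<noteq> k"
  shows "reduced i l (w * v)"
  using assms
proof (induction)
  case (block k l b)
  then show ?case by (auto intro: reduced.snoc)
next
  case (snoc k l v k' l' b)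
  then have "reduced i l' ((w * v) * b)" by (auto intro: reduced.snoc)
  then show ?case by (simp add: mult.assoc)
qed

section \<open>Matrices with entries spanned by reduced words\<close>

lemma span_mult:
  assumes "x \<in> span S" "y \<in> span T" "\<And>s t. s \<in> S \<Longrightarrow> t \<in> T \<Longrightarrow> s * t \<in> U"
  shows "x * y \<in> span U"
proof -
  have "s * y \<in> span U" if "s \<in> S" for s
    using assms(2)
  proof (induction rule: span_induct_alt)
    case (step c t z)
    have "s * t \<in> span U" using assms(3) that step(1) by (intro span_base)
    then show ?case
      using step(2) by (auto simp: distrib_left scale_mult_right intro: span_add span_scale)
  qed (simp add: span_zero)
  with assms(1) show ?thesis
  proof (induction rule: span_induct_alt)
    case (step c t z)
    then show ?case
      by (auto simp: distrib_right scale_mult_left intro!: span_add span_scale)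
  qed (simp add: span_zero)
qed

text \<open>\<open>L\<close> and \<open>R\<close> constrain the outer indices of the reduced words
  in an entry relative to its own row and column. Two such matrices can be multiplied when, at every
  common vertex, the last index allowed by \<open>R\<close> differs from the first index allowed by
  the next \<open>L\<close>.\<close>

definition reduced_mat :: "(nat \<Rightarrow> nat \<Rightarrow> bool) \<Rightarrow> (nat \<Rightarrow> nat \<Rightarrow> bool) \<Rightarrow> 'a mat \<Rightarrow> bool" where
  "reduced_mat L R Z \<longleftrightarrow> Z \<in> carrier_mat d d \<and>
     (\<forall>a<d. \<forall>b<d. Z $$ (a, b) \<in> span {w. \<exists>i j. L a i \<and> R b j \<and> reduced i j w})"

lemma reduced_mat_mult:
  assumes "reduced_mat L R Z" "reduced_mat L' R' Z'" "\<And>b i j. b < d \<Longrightarrow> R b i \<Longrightarrow> L' b j \<Longrightarrow> i \<noteq> j"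
  shows "reduced_mat L R' (Z * Z')"
proof -
  have car: "Z \<in> carrier_mat d d" "Z' \<in> carrier_mat d d"
    using assms(1,2) by (auto simp: reduced_mat_def)
  have "(Z * Z') $$ (a, c) \<in> span {w. \<exists>i j. L a i \<and> R' c j \<and> reduced i j w}" if ac: "a < d" "c < d" for a c
    unfolding mult_mat_index[OF car ac]
  proof (rule span_sum)
    fix b assume "b \<in> {..<d}"
    then have b: "b < d" by simp
    show "Z $$ (a, b) * Z' $$ (b, c) \<in> span {w. \<exists>i j. L a i \<and> R' c j \<and> reduced i j w}"
    proof (rule span_mult)
      show "Z $$ (a, b) \<in> span {w. \<exists>i j. L a i \<and> R b j \<and> reduced i j w}"
        using assms(1) ac b by (simp add: reduced_mat_def)
      show "Z' $$ (b, c) \<in> span {w. \<exists>i j. L' b i \<and> R' c j \<and> reduced i j w}"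
        using assms(2) ac b by (simp add: reduced_mat_def)
    qed (use assms(3)[OF b] reduced_append in blast)
  qed
  with car show ?thesis by (auto simp: reduced_mat_def)
qed

lemma tau_span_reduced:
  assumes "x \<in> span {w. \<exists>i j. L a i \<and> R b j \<and> reduced i j w}"
  shows "\<tau> x = 0"
  by (rule tau.eq_0_on_span[OF _ assms]) (auto simp: tau_reduced)

lemma cond_exp_reduced_mat:
  assumes "reduced_mat L R Z"
  shows "cond_exp scale \<tau> d Z = 0\<^sub>m d d"
proof (rule eq_matI)
  fix i j assume "i < dim_row (0\<^sub>m d d :: 'a mat)" "j < dim_col (0\<^sub>m d d :: 'a mat)"
  then have "i < d" "j < d" by auto
  moreover from this assms have "\<tau> (Z $$ (i, i)) = 0"
    by (intro tau_span_reduced[of _ L i R i]) (simp add: reduced_mat_def)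
  ultimately show "cond_exp scale \<tau> d Z $$ (i, j) = 0\<^sub>m d d $$ (i, j)"
    by (cases "i = j") (auto simp: cond_exp_index)
qed (use carrier_matD[OF cond_exp_carrier] in auto)

end

section \<open>Walks on the integers modulo d\<close>

definition shift :: "nat \<Rightarrow> int \<Rightarrow> nat \<Rightarrow> nat" where
  "shift d e a = nat ((int a + e) mod int d)"

lemma shift_less: "a < d \<Longrightarrow> shift d e a < d"
  by (simp add: shift_def nat_less_iff)

lemma int_shift: "a < d \<Longrightarrow> int (shift d e a) = (int a + e) mod int d"
  by (simp add: shift_def)

lemma shift_shift: "a < d \<Longrightarrow> shift d e (shift d f a) = shift d (e + f) a"
  by (simp add: shift_def[of d e] shift_def[of d "e + f"] int_shift mod_simps algebra_simps)

lemma shift_zero: "a < d \<Longrightarrow> shift d 0 a = a"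
  by (simp add: shift_def)

lemma shift_eq_iff: "a < d \<Longrightarrow> shift d e a = shift d f a \<longleftrightarrow> int d dvd e - f"
proof -
  assume a: "a < d"
  have "shift d e a = shift d f a \<longleftrightarrow> int (shift d e a) = int (shift d f a)" by simp
  also have "\<dots> \<longleftrightarrow> int d dvd (int a + e) - (int a + f)"
    by (simp only: int_shift[OF a] mod_eq_dvd_iff)
  finally show ?thesis by simp
qed

lemma shift_swap: "a < d \<Longrightarrow> b < d \<Longrightarrow> b = shift d e a \<longleftrightarrow> a = shift d (- e) b"
  using shift_shift[of a d "- e" e] shift_shift[of b d e "- e"] by (auto simp: shift_zero)

context free_from_scalars
begin

abbreviation sh :: "int \<Rightarrow> nat \<Rightarrow> nat" where "sh \<equiv> shift d"

text \<open>Integer indices let a step backwards be a negative number, so that the diagonals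
  \<open>k\<close> and \<open>d - k\<close> become the letters of the steps \<open>k\<close> and
  \<open>- k\<close>.\<close>

definition letter :: "int \<Rightarrow> 'a mat" where
  "letter e = mat d d (\<lambda>(a, b). if b = sh e a then X $$ (b, a) else 0)"

lemma letter_carrier: "letter e \<in> carrier_mat d d"
  by (simp add: letter_def)

lemma letter_index: "a < d \<Longrightarrow> b < d \<Longrightarrow> letter e $$ (a, b) = (if b = sh e a then X $$ (b, a) else 0)"
  by (simp add: letter_def)

lemma diag_part_transpose: "diag_part d (transpose_mat X) k = letter (int k)"
proof (rule eq_matI)
  fix a b assume "a < dim_row (letter (int k))" "b < dim_col (letter (int k))"
  then have ab: "a < d" "b < d" by (auto simp: letter_def)
  have "b mod d = (a + k) mod d \<longleftrightarrow> b = sh (int k) a"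
    using ab by (simp add: shift_def flip: of_nat_add of_nat_mod)
  with ab show "diag_part d (transpose_mat X) k $$ (a, b) = letter (int k) $$ (a, b)"
    using X_carrier by (simp add: diag_part_def letter_index)
qed (auto simp: diag_part_def letter_def)

lemma letter_minus: "k \<le> d \<Longrightarrow> letter (int (d - k)) = letter (- int k)"
  by (rule eq_matI) (auto simp: letter_def of_nat_diff shift_eq_iff)

definition adj :: "nat \<Rightarrow> nat \<Rightarrow> nat \<Rightarrow> bool" where
  "adj k a b \<longleftrightarrow> b = sh (int k) a \<or> b = sh (- int k) a"

lemma adj_less: "a < d \<Longrightarrow> adj k a b \<Longrightarrow> b < d"
  by (auto simp: adj_def shift_less)

lemma adj_sym: "a < d \<Longrightarrow> b < d \<Longrightarrow> adj k a b \<longleftrightarrow> adj k b a"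
  unfolding adj_def using shift_swap[of a d b "int k"] shift_swap[of a d b "- int k"] by auto

text \<open>The steps have absolute value at most \<open>d / 2\<close>, and as
  \<open>k \<noteq> l\<close> the bound is not attained by both. Their difference is therefore
  nonzero and smaller than \<open>d\<close> in absolute value, so it is no multiple of
  \<open>d\<close>.\<close>

lemma adj_neq:
  assumes "a < d" "adj k a i" "adj l a j" "k \<noteq> l" "2 * k \<le> d" "2 * l \<le> d"
  shows "i \<noteq> j"
proof
  assume "i = j"
  with assms(1-3) obtain e f where ef: "e = int k \<or> e = - int k" "f = int l \<or> f = - int l" "sh e a = sh f a"
    by (auto simp: adj_def)
  then have "int d dvd e - f" using shift_eq_iff assms(1) by blast
  moreover have "e - f \<noteq> 0" using ef assms(4) by auto
  ultimately have "int d \<le> \<bar>e - f\<bar>" by (simp add: zdvd_imp_le)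
  with ef assms(4-6) show False by auto
qed

text \<open>
  A word \<open>w\<close> of centered blocks following a walk from \<open>a\<close> to \<open>b\<close> with steps \<open>\<plusminus>k\<close>. Each block is a
  maximal back-and-forth stretch over one edge, starting at \<open>b\<close> towards the neighbour \<open>u\<close>, ending at \<open>v\<close> and
  coming from \<open>v'\<close>; since the factor of a step from \<open>i\<close> to \<open>j\<close> is the transposed entry \<open>(j, i)\<close>, the block
  lies in \<open>corner u v'\<close>. The option records the vertex visited just before \<open>b\<close>.
\<close>

inductive walk_word :: "nat \<Rightarrow> nat \<Rightarrow> nat \<Rightarrow> nat option \<Rightarrow> 'a \<Rightarrow> bool" for k where
  Nil: "a < d \<Longrightarrow> walk_word k a a None 1"
| snoc: "walk_word k a b p w \<Longrightarrow> adj k b u \<Longrightarrow> (v = b \<and> v' = u) \<or> (v = u \<and> v' = b) \<Longrightarrow>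
    z \<in> corner u v' \<Longrightarrow> \<tau> z = 0 \<Longrightarrow> p \<noteq> Some u \<Longrightarrow> walk_word k a v (Some v') (w * z)"

text \<open>The option \<open>p\<close> stores the column index of the last block. The side
  condition \<open>p \<noteq> Some u\<close> of \<open>snoc\<close> therefore says that this block
  and the next do not compose, which is what a reduced word requires.\<close>

lemma walk_word_reduced:
  assumes "walk_word k a b p w"
  shows "a < d \<and> b < d \<and> (p = None \<and> w = 1 \<and> a = b \<or> (\<exists>i j. p = Some j \<and> adj k a i \<and> adj k b j \<and> reduced i j w))"
  using assms
proof induction
  case (snoc a b p w u v v' z)
  then have bu: "b < d" "u < d" using adj_less by blast+
  then have v: "v < d" "v' < d" "adj k v v'"
    using snoc.hyps adj_sym by auto
  from snoc.IH consider "p = None" "w = 1" "a = b"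
    | i j where "p = Some j" "adj k a i" "reduced i j w" by blast
  then show ?case
  proof cases
    case 1
    then show ?thesis using snoc bu v by (auto intro: reduced.block)
  next
    case 2
    then show ?thesis using snoc bu v by (auto intro: reduced.snoc)
  qed
qed simp

lemma tau_center: "\<tau> (z - scale (\<tau> z) 1) = 0"
  by (simp add: tau.diff tau.scale unital_functional)

text \<open>If the walk does not turn back, the new entry starts a block of its own; if it does, the
  last block absorbs the entry. A block in an off-diagonal corner is automatically centered. In a
  diagonal corner its expectation is subtracted, and the scalar remainder multiplies the walk word
  with that block deleted.\<close>

lemma walk_word_step:
  assumes w: "walk_word k a b p w" and bc: "adj k b c"
  shows "w * X $$ (c, b) \<in> span {w. \<exists>p. walk_word k a c p w}"
proof -
  have b: "b < d" using walk_word_reduced[OF w] by blast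
  have c: "c < d" using adj_less[OF b bc] .
  note Xcb = corner_X[OF c b]
  show ?thesis
  proof (cases "p = Some c")
    case False
    show ?thesis
    proof (cases "b = c")
      case False
      then have "walk_word k a c (Some b) (w * X $$ (c, b))"
        using w bc \<open>p \<noteq> Some c\<close> Xcb tau_corner[OF Xcb c b] by (intro walk_word.snoc) auto
      then show ?thesis by (intro span_base) blast
    next
      case True
      let ?x = "X $$ (c, b)"
      have "walk_word k a c (Some b) (w * (?x - scale (\<tau> ?x) 1))"
        using w bc \<open>p \<noteq> Some c\<close> Xcb True corner_one[of c]
        by (intro walk_word.snoc tau_center corner_diff corner_scale) auto
      moreover have "walk_word k a c p w" using w True by simp
      ultimately have "w * (?x - scale (\<tau> ?x) 1) + scale (\<tau> ?x) w \<in> span {w. \<exists>p. walk_word k a c p w}"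
        by (intro span_add span_scale span_base) blast+
      then show ?thesis by (simp add: right_diff_distrib mult_scale_one)
    qed
  next
    case True
    from w True obtain b0 p0 w0 u z where z: "w = w0 * z" "walk_word k a b0 p0 w0" "adj k b0 u"
      "(b = b0 \<and> c = u) \<or> (b = u \<and> c = b0)" "z \<in> corner u c" "p0 \<noteq> Some u"
      by (cases rule: walk_word.cases) auto
    have b0: "b0 < d" using walk_word_reduced[OF z(2)] by blast
    have u: "u < d" using adj_less[OF b0 z(3)] .
    let ?x = "z * X $$ (c, b)"
    have x: "?x \<in> corner u b" by (rule corner_mult[OF u c b z(5) Xcb])
    \<comment> \<open>Turning back exchanges the end point of the last block with the vertex before
      it, while the block keeps its edge and its initial corner index \<open>u\<close>.\<close>
    have cb: "(c = b0 \<and> b = u) \<or> (c = u \<and> b = b0)" using z(4) by blast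
    show ?thesis
    proof (cases "u = b")
      case False
      then have "walk_word k a c (Some b) (w0 * ?x)"
        using tau_corner[OF x u b] by (intro walk_word.snoc[OF z(2,3) cb x _ z(6)]) auto
      then show ?thesis by (intro span_base) (auto simp: z(1) mult.assoc)
    next
      case True
      then have "1 \<in> corner u b" using corner_one by simp
      then have "walk_word k a c (Some b) (w0 * (?x - scale (\<tau> ?x) 1))"
        using x by (intro walk_word.snoc[OF z(2,3) cb _ _ z(6)] tau_center corner_diff corner_scale)
      \<comment> \<open>The stretch has returned to its starting vertex \<open>b0\<close>, which is
        now \<open>c\<close>, so deleting the block still leaves a walk word ending at
        \<open>c\<close>.\<close>
      moreover have "walk_word k a c p0 w0" using z(2) cb True by auto
      ultimately have "w0 * (?x - scale (\<tau> ?x) 1) + scale (\<tau> ?x) w0 \<in> span {w. \<exists>p. walk_word k a c p w}"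
        by (intro span_add span_scale span_base) blast+
      then show ?thesis by (simp add: right_diff_distrib mult_scale_one z(1) mult.assoc)
    qed
  qed
qed

section \<open>The algebra generated by two opposite letters\<close>

definition walk_mat :: "nat \<Rightarrow> 'a mat \<Rightarrow> bool" where
  "walk_mat k Z \<longleftrightarrow> Z \<in> carrier_mat d d \<and>
     (\<forall>a<d. \<forall>b<d. Z $$ (a, b) \<in> span {w. \<exists>p. walk_word k a b p w})"

lemma walk_mat_one: "walk_mat k (1\<^sub>m d)"
  unfolding walk_mat_def by (auto intro!: span_zero span_base intro: walk_word.Nil)

lemma walk_mat_add: "walk_mat k Y \<Longrightarrow> walk_mat k Z \<Longrightarrow> walk_mat k (Y + Z)"
  by (auto simp: walk_mat_def intro!: span_add)

lemma walk_mat_scale: "walk_mat k Z \<Longrightarrow> walk_mat k (map_mat (scale c) Z)"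
  by (auto simp: walk_mat_def intro!: span_scale)

lemma walk_mat_letter:
  assumes Z: "walk_mat k Z" and e: "e = int k \<or> e = - int k"
  shows "walk_mat k (Z * letter e)"
proof -
  have car: "Z \<in> carrier_mat d d" using Z by (simp add: walk_mat_def)
  have "(Z * letter e) $$ (a, c) \<in> span {w. \<exists>p. walk_word k a c p w}" if ac: "a < d" "c < d" for a c
    unfolding mult_mat_index[OF car letter_carrier ac]
  proof (rule span_sum)
    fix b assume "b \<in> {..<d}"
    then have b: "b < d" by simp
    show "Z $$ (a, b) * letter e $$ (b, c) \<in> span {w. \<exists>p. walk_word k a c p w}"
    proof (cases "c = sh e b")
      case False
      then show ?thesis using b ac by (simp add: letter_index span_zero)
    next
      case True
      with e have bc: "adj k b c" by (auto simp: adj_def)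
      have "Z $$ (a, b) \<in> span {w. \<exists>p. walk_word k a b p w}"
        using Z ac b by (simp add: walk_mat_def)
      then have "Z $$ (a, b) * X $$ (c, b) \<in> span {w. \<exists>p. walk_word k a c p w}"
      proof (induction rule: span_induct_alt)
        case (step r w y)
        then have "w * X $$ (c, b) \<in> span {w. \<exists>p. walk_word k a c p w}"
          using walk_word_step[OF _ bc] by blast
        then show ?case
          using step by (auto simp: distrib_right scale_mult_left intro!: span_add span_scale)
      qed (simp add: span_zero)
      then show ?thesis using True b ac by (simp add: letter_index)
    qed
  qed
  with car show ?thesis by (auto simp: walk_mat_def letter_def)
qed

lemma alg_letters_carrier:
  "S \<subseteq> {letter e, letter f} \<Longrightarrow> Z \<in> alg_over_diag scale d S \<Longrightarrow> Z \<in> carrier_mat d d"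
  by (rule alg_carrier) (auto simp: letter_def)

text \<open>Walks are extended at the end only, so membership is tracked through right
  multiplication. With \<open>U\<close> arbitrary, a product \<open>x * y\<close> is handled by
  applying the hypothesis for \<open>x\<close> and then that for \<open>y\<close>.\<close>

lemma walk_mat_alg:
  assumes S: "S \<subseteq> {letter (int k), letter (- int k)}"
  shows "Z \<in> alg_over_diag scale d S \<Longrightarrow> walk_mat k U \<Longrightarrow> walk_mat k (U * Z)"
proof (induction Z arbitrary: U rule: alg_over_diag.induct)
  case (gen x)
  then show ?case using S walk_mat_letter by auto
next
  case (diag D)
  have U: "U \<in> carrier_mat d d" using diag by (simp add: walk_mat_def)
  have "(U * D) $$ (a, b) \<in> span {w. \<exists>p. walk_word k a b p w}" if ab: "a < d" "b < d" for a b
  proof -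
    obtain c where "D $$ (b, b) = scale c 1" using diag_scalars_entry[OF diag(1) ab(2)] by blast
    then show ?thesis
      using diag(2) ab unfolding mult_diag_index[OF diag(1) U ab]
      by (auto simp: mult_scale_one walk_mat_def intro!: span_scale)
  qed
  then show ?case using U diag_scalars_carrier[OF diag(1)] by (auto simp: walk_mat_def)
next
  case (add x y)
  have car: "U \<in> carrier_mat d d" "x \<in> carrier_mat d d" "y \<in> carrier_mat d d"
    using add alg_letters_carrier[OF S] by (auto simp: walk_mat_def)
  have "U * (x + y) = U * x + U * y" by (rule mult_add_distrib_mat[OF car])
  moreover have "walk_mat k (U * x)" "walk_mat k (U * y)" using add by auto
  ultimately show ?case using walk_mat_add by simp
next
  case (mult x y)
  have car: "U \<in> carrier_mat d d" "x \<in> carrier_mat d d" "y \<in> carrier_mat d d"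
    using mult alg_letters_carrier[OF S] by (auto simp: walk_mat_def)
  have "U * (x * y) = U * x * y" by (rule assoc_mult_mat[OF car, symmetric])
  then show ?case using mult by simp
next
  case (smult x c)
  have car: "U \<in> carrier_mat d d" "x \<in> carrier_mat d d"
    using smult alg_letters_carrier[OF S] by (auto simp: walk_mat_def)
  have "U * map_mat (scale c) x = map_mat (scale c) (U * x)"
    by (rule eq_matI) (use car in \<open>auto simp: mult_mat_index[of _ d] scale_mult_right scale_sum_right
      simp del: index_mult_mat(1)\<close>)
  moreover have "walk_mat k (U * x)" using smult by auto
  ultimately show ?case using walk_mat_scale by simp
qed

text \<open>Off the diagonal no empty walk occurs, so all walk words are reduced. On the diagonal
  the empty walk contributes only a scalar multiple of \<open>1\<close>. Because reduced words have
  expectation zero, this scalar is the value of \<open>\<tau>\<close> at the entry, and it vanishes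
  since \<open>Z\<close> is centered.\<close>

lemma walk_mat_reduced:
  assumes Z: "walk_mat k Z" and E: "cond_exp scale \<tau> d Z = 0\<^sub>m d d"
  shows "reduced_mat (adj k) (adj k) Z"
  unfolding reduced_mat_def
proof (intro conjI allI impI)
  show "Z \<in> carrier_mat d d" using Z by (simp add: walk_mat_def)
  fix a b assume ab: "a < d" "b < d"
  let ?R = "{w. \<exists>i j. adj k a i \<and> adj k b j \<and> reduced i j w}"
  have Zab: "Z $$ (a, b) \<in> span {w. \<exists>p. walk_word k a b p w}"
    using Z ab by (simp add: walk_mat_def)
  show "Z $$ (a, b) \<in> span ?R"
  proof (cases "a = b")
    case False
    then have "{w. \<exists>p. walk_word k a b p w} \<subseteq> ?R" using walk_word_reduced by blast
    from span_mono[OF this] Zab show ?thesis by blast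
  next
    case True
    have "{w. \<exists>p. walk_word k a b p w} \<subseteq> insert 1 ?R" using walk_word_reduced by blast
    from span_mono[OF this] Zab have "Z $$ (a, b) \<in> span (insert 1 ?R)" by blast
    then obtain c where c: "Z $$ (a, b) - scale c 1 \<in> span ?R" by (auto simp: span_breakdown_eq)
    have "scale (\<tau> (Z $$ (a, a))) 1 = 0"
      using arg_cong[OF E, of "\<lambda>A. A $$ (a, a)"] ab by (simp add: cond_exp_index)
    then have "\<tau> (Z $$ (a, b)) = 0" using True by (simp add: scale_eq_0_iff)
    then have "c = 0"
      using tau_span_reduced[of _ "adj k" a "adj k" b, OF c] by (simp add: tau.diff tau.scale unital_functional)
    with c show ?thesis by simp
  qed
qed

text \<open>Each centered factor is a matrix of reduced words whose outer indices are neighbours by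
  steps of its own \<open>k\<close>. Consecutive factors have different \<open>k\<close>, so by
  \<open>adj_neq\<close> their words never compose at a common vertex, and the product again
  consists of reduced words.\<close>

theorem free_letter_pairs:
  assumes S: "\<And>k. k \<in> I \<Longrightarrow> S k \<subseteq> {letter (int k), letter (- int k)}" and I: "\<And>k. k \<in> I \<Longrightarrow> 2 * k \<le> d"
  shows "free_sets scale \<tau> d I S"
  unfolding free_sets_def free_algs_def
proof (intro allI impI)
  fix ks :: "nat list" and Zs :: "'a mat list"
  assume "ks \<noteq> []" "length Zs = length ks" "set ks \<subseteq> I"
    "\<forall>j<length ks. Zs ! j \<in> alg_over_diag scale d (S (ks ! j)) \<and> cond_exp scale \<tau> d (Zs ! j) = 0\<^sub>m d d"
    "\<forall>j. Suc j < length ks \<longrightarrow> ks ! j \<noteq> ks ! Suc j"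
  then have "reduced_mat (adj (hd ks)) (adj (last ks)) (mat_list_prod d Zs)"
  proof (induction ks arbitrary: Zs)
    case (Cons k ks)
    then obtain Z Zs' where Zs: "Zs = Z # Zs'" "length Zs' = length ks" by (cases Zs) auto
    have Z: "Z \<in> alg_over_diag scale d (S k)" "cond_exp scale \<tau> d Z = 0\<^sub>m d d" and kI: "k \<in> I"
      using Cons.prems(3) Cons.prems(4)[rule_format, of 0] Zs by auto
    have Zc: "Z \<in> carrier_mat d d"
      by (rule alg_letters_carrier[OF S[OF kI] Z(1)])
    have "walk_mat k (1\<^sub>m d * Z)"
      by (rule walk_mat_alg[OF S[OF kI] Z(1) walk_mat_one])
    then have red: "reduced_mat (adj k) (adj k) Z"
      using Zc Z(2) by (intro walk_mat_reduced) simp_all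
    show ?case
    proof (cases "ks = []")
      case True
      then show ?thesis using red Zs Zc by (simp add: mat_list_prod_def)
    next
      case False
      have "reduced_mat (adj (hd ks)) (adj (last ks)) (mat_list_prod d Zs')"
      proof (rule Cons.IH[OF False Zs(2)])
        show "set ks \<subseteq> I" using Cons.prems(3) by simp
        show "\<forall>j<length ks. Zs' ! j \<in> alg_over_diag scale d (S (ks ! j)) \<and> cond_exp scale \<tau> d (Zs' ! j) = 0\<^sub>m d d"
          using Cons.prems(4)[rule_format, of "Suc _"] Zs(1) by simp
        show "\<forall>j. Suc j < length ks \<longrightarrow> ks ! j \<noteq> ks ! Suc j"
          using Cons.prems(5)[rule_format, of "Suc _"] by simp
      qed
      moreover have "k \<noteq> hd ks" using Cons.prems(5)[rule_format, of 0] False by (simp add: hd_conv_nth)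
      moreover have "hd ks \<in> I" using False Cons.prems(3) by auto
      ultimately have "reduced_mat (adj k) (adj (last ks)) (Z * mat_list_prod d Zs')"
        using I kI by (intro reduced_mat_mult[OF red _ adj_neq[of _ k _ "hd ks"]])
      then show ?thesis using False Zs(1) by (simp add: mat_list_prod_def)
    qed
  qed simp
  then show "cond_exp scale \<tau> d (mat_list_prod d Zs) = 0\<^sub>m d d"
    by (rule cond_exp_reduced_mat)
qed

end

section \<open>R-diagonality\<close>

lemma appell_map: "appell d f \<kappa> (map g bs) = appell d (\<lambda>b. f (g b)) (\<lambda>cs. \<kappa> (map g cs)) bs"
proof (induction bs rule: length_induct)
  case (1 bs)
  show ?case
  proof (cases bs)
    case (Cons b cs)
    with 1 have IH: "appell d f \<kappa> (map g es) = appell d (\<lambda>b. f (g b)) (\<lambda>cs. \<kappa> (map g cs)) es"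
      if "length es \<le> length cs" for es using that by auto
    have "appell d f \<kappa> (drop s (map g cs)) = appell d (\<lambda>b. f (g b)) (\<lambda>cs. \<kappa> (map g cs)) (drop s cs)" for s
      using IH[of "drop s cs"] by (simp add: drop_map)
    then show ?thesis
      using Cons IH[of cs] by (simp add: take_map)
  qed simp
qed

lemma appell_cong:
  assumes "\<And>xs ys zs. bs = xs @ ys @ zs \<Longrightarrow> ys \<noteq> [] \<Longrightarrow> \<kappa> ys = \<kappa>' ys"
  shows "appell d f \<kappa> bs = appell d f \<kappa>' bs"
  using assms
proof (induction bs rule: length_induct)
  case (1 bs)
  show ?case
  proof (cases bs)
    case (Cons b cs)
    have IH: "appell d f \<kappa> (drop s cs) = appell d f \<kappa>' (drop s cs)" for s
    proof -
      have "\<kappa> ys = \<kappa>' ys" if "drop s cs = xs @ ys @ zs" "ys \<noteq> []" for xs ys zs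
      proof (rule 1(2))
        have "(b # take s cs @ xs) @ ys @ zs = b # (take s cs @ drop s cs)"
          by (simp only: that(1) append_Cons append_assoc)
        then show "bs = (b # take s cs @ xs) @ ys @ zs" by (simp only: append_take_drop_id Cons)
      qed (rule that(2))
      then have "\<forall>xs ys zs. drop s cs = xs @ ys @ zs \<longrightarrow> ys \<noteq> [] \<longrightarrow> \<kappa> ys = \<kappa>' ys" by blast
      moreover have "length (drop s cs) < length bs" using Cons by simp
      ultimately show ?thesis using 1(1) by blast
    qed
    have take: "\<kappa> (take (Suc s) (b # cs)) = \<kappa>' (take (Suc s) (b # cs))" for s
    proof (rule 1(2))
      show "bs = [] @ take (Suc s) (b # cs) @ drop (Suc s) (b # cs)"
        by (simp only: Cons append_take_drop_id append_Nil)
    qed simp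
    show ?thesis
      by (simp only: Cons appell.simps IH IH[of 0, unfolded drop_0] take)
  qed simp
qed

text \<open>In the recursion, an initial segment that crosses the seam contains \<open>x\<close>
  followed by \<open>y\<close>, and \<open>\<kappa>\<close> vanishes on it. The surviving terms are
  those of \<open>us @ [x]\<close>, each with the common right factor
  \<open>appell d f \<kappa> ([y] @ vs)\<close> by induction.\<close>

lemma (in nc_prob_space) appell_break:
  fixes f :: "'b \<Rightarrow> 'a mat"
  assumes f: "\<And>b. f b \<in> carrier_mat d d" and \<kappa>: "\<And>bs. \<kappa> bs \<in> carrier_mat d d"
    and br: "\<And>xs ys. \<kappa> (xs @ [x, y] @ ys) = 0\<^sub>m d d"
  shows "appell d f \<kappa> (us @ [x] @ [y] @ vs) = appell d f \<kappa> (us @ [x]) * appell d f \<kappa> ([y] @ vs)"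
proof -
  let ?A = "appell d f \<kappa>"
  define v where "v = [y] @ vs"
  define V where "V = ?A v"
  have VC: "V \<in> carrier_mat d d" by (simp add: V_def appell_carrier)
  \<comment> \<open>The left word may be empty, so that the induction covers all suffixes
    \<open>drop s cs\<close>.\<close>
  have "bs = [] \<or> last bs = x \<Longrightarrow> ?A (bs @ v) = ?A bs * V" for bs
  proof (induction bs rule: length_induct)
    case (1 bs)
    show ?case
    proof (cases bs)
      case Nil
      then show ?thesis using left_mult_one_mat[OF VC] by (simp add: V_def)
    next
      case (Cons b cs)
      have IH: "?A (drop s cs @ v) = ?A (drop s cs) * V" for s
      proof -
        have "drop s cs = [] \<or> last (drop s cs) = x"
          using 1(2) Cons by (cases "s < length cs") (auto simp: last_drop)
        moreover have "length (drop s cs) < length bs" using Cons by simp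
        ultimately show ?thesis using 1(1) by blast
      qed
      define t where "t s = \<kappa> (take (Suc s) (b # cs @ v)) * ?A (drop s (cs @ v))" for s
      define t' where "t' s = \<kappa> (take (Suc s) (b # cs)) * ?A (drop s cs)" for s
      have t'C: "t' s \<in> carrier_mat d d" for s
        unfolding t'_def by (rule mult_carrier_mat[OF \<kappa> appell_carrier])
      have t: "t s = t' s * V" if "s \<le> length cs" for s
      proof -
        have "t s = \<kappa> (take (Suc s) (b # cs)) * (?A (drop s cs) * V)"
          using that by (simp add: t_def flip: IH)
        then show ?thesis unfolding t'_def by (simp only: assoc_mult_mat[OF \<kappa> appell_carrier VC])
      qed
      have z: "t s = 0\<^sub>m d d" if "s > length cs" for s
      proof -
        have "bs = butlast bs @ [x]" using 1(2) Cons append_butlast_last_id[of bs] by simp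
        moreover have "take (Suc s) (b # cs @ v) = bs @ y # take (s - length bs) vs"
        proof -
          have "Suc s - length bs = Suc (s - length bs)" "length bs \<le> Suc s" using that Cons by auto
          then have "take (Suc s) (bs @ v) = bs @ y # take (s - length bs) vs"
            by (simp only: take_append take_all v_def append_Cons append_Nil take_Suc_Cons)
          then show ?thesis using Cons by simp
        qed
        ultimately have "take (Suc s) (b # cs @ v) = butlast bs @ [x, y] @ take (s - length bs) vs"
          by (metis append.assoc append_Cons append_Nil)
        then show ?thesis by (simp only: t_def br left_mult_zero_mat[OF appell_carrier])
      qed
      have "matsum d t {..length (cs @ v)} = matsum d t {..length cs}"
      proof -
        have "(\<Sum>s\<le>length (cs @ v). t s $$ ij) = (\<Sum>s\<le>length cs. t s $$ ij)" if "ij \<in> {..<d} \<times> {..<d}" for ij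
        proof (rule sum.mono_neutral_right)
          show "\<forall>s\<in>{..length (cs @ v)} - {..length cs}. t s $$ ij = 0"
            using that by (auto simp: z not_le)
        qed auto
        then show ?thesis unfolding matsum_def by (intro cong_mat) auto
      qed
      also have "\<dots> = matsum d t' {..length cs} * V"
      proof (rule eq_matI)
        fix i j assume "i < dim_row (matsum d t' {..length cs} * V)" "j < dim_col (matsum d t' {..length cs} * V)"
        then have ij: "i < d" "j < d" using VC by (auto simp: matsum_def)
        have "(\<Sum>s\<le>length cs. t s $$ (i, j)) = (\<Sum>s\<le>length cs. (\<Sum>k<d. t' s $$ (i, k) * V $$ (k, j)))"
          by (rule sum.cong) (simp_all add: t mult_mat_index[OF t'C VC ij] del: index_mult_mat(1))
        also have "\<dots> = (\<Sum>k<d. (\<Sum>s\<le>length cs. t' s $$ (i, k)) * V $$ (k, j))"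
          by (subst sum.swap) (simp add: sum_distrib_right)
        also have "\<dots> = (\<Sum>k<d. matsum d t' {..length cs} $$ (i, k) * V $$ (k, j))"
          using ij by (simp add: matsum_def)
        also have "\<dots> = (matsum d t' {..length cs} * V) $$ (i, j)"
          by (rule mult_mat_index[OF _ VC ij, symmetric]) (simp add: matsum_def)
        finally show "matsum d t {..length cs} $$ (i, j) = (matsum d t' {..length cs} * V) $$ (i, j)"
          using ij by (simp add: matsum_def)
      qed (use VC in \<open>auto simp: matsum_def\<close>)
      finally have ms: "matsum d t {..length (cs @ v)} = matsum d t' {..length cs} * V" .
      have "?A (bs @ v) = f b * ?A (cs @ v) - matsum d t {..length (cs @ v)}"
        by (simp only: Cons append_Cons appell.simps t_def[abs_def])
      also have "f b * ?A (cs @ v) = f b * ?A cs * V"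
      proof -
        have "?A (cs @ v) = ?A cs * V" using IH[of 0] by simp
        then show ?thesis by (simp only: assoc_mult_mat[OF f appell_carrier VC])
      qed
      also have "f b * ?A cs * V - matsum d t {..length (cs @ v)} =
          (f b * ?A cs - matsum d t' {..length cs}) * V"
        unfolding ms
        by (rule minus_mult_distrib_mat[OF mult_carrier_mat[OF f appell_carrier] _ VC, symmetric])
          (simp add: matsum_def)
      also have "f b * ?A cs - matsum d t' {..length cs} = ?A bs"
        by (simp only: Cons appell.simps t'_def[abs_def])
      finally show ?thesis .
    qed
  qed
  from this[of "us @ [x]"] show ?thesis by (simp add: V_def v_def del: appell.simps)
qed

section \<open>Alternating sign words\<close>

fun alternating :: "int list \<Rightarrow> bool" where
  "alternating (e # f # es) \<longleftrightarrow> e = - f \<and> alternating (f # es)"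
| "alternating _ \<longleftrightarrow> True"

lemma alternating_iff: "alternating es \<longleftrightarrow> (\<forall>i. Suc i < length es \<longrightarrow> es ! i = - es ! Suc i)"
proof (induction es rule: alternating.induct)
  case (1 e f es)
  have "(\<forall>i. Suc i < length (e # f # es) \<longrightarrow> (e # f # es) ! i = - (e # f # es) ! Suc i) \<longleftrightarrow>
      e = - f \<and> (\<forall>i. Suc i < length (f # es) \<longrightarrow> (f # es) ! i = - (f # es) ! Suc i)"
  proof (intro iffI conjI allI impI)
    assume *: "\<forall>i. Suc i < length (e # f # es) \<longrightarrow> (e # f # es) ! i = - (e # f # es) ! Suc i"
    from *[rule_format, of 0] show "e = - f" by simp
    show "(f # es) ! i = - (f # es) ! Suc i" if "Suc i < length (f # es)" for i
      using *[rule_format, of "Suc i"] that by simp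
  next
    fix i assume *: "e = - f \<and> (\<forall>i. Suc i < length (f # es) \<longrightarrow> (f # es) ! i = - (f # es) ! Suc i)"
      and i: "Suc i < length (e # f # es)"
    show "(e # f # es) ! i = - (e # f # es) ! Suc i"
    proof (cases i)
      case 0
      then show ?thesis using * by simp
    next
      case (Suc j)
      then show ?thesis using *[THEN conjunct2, rule_format, of j] i by simp
    qed
  qed
  with 1 show ?case by simp
qed auto

lemma alternating_append: "alternating (xs @ ys) \<Longrightarrow> alternating xs \<and> alternating ys"
  unfolding alternating_iff
proof (intro conjI allI impI)
  assume *: "\<forall>i. Suc i < length (xs @ ys) \<longrightarrow> (xs @ ys) ! i = - (xs @ ys) ! Suc i"
  show "xs ! i = - xs ! Suc i" if "Suc i < length xs" for i
    using *[rule_format, of i] that by (simp add: nth_append)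
  show "ys ! i = - ys ! Suc i" if "Suc i < length ys" for i
    using *[rule_format, of "length xs + i"] that by (simp add: nth_append)
qed

lemma alternating_hd_drop:
  "alternating es \<Longrightarrow> s < length es \<Longrightarrow> hd (drop s es) = (if even s then hd es else - hd es)"
proof (induction es arbitrary: s rule: alternating.induct)
  case (1 e f es)
  then show ?case by (cases s) auto
qed auto

lemma not_alternating_break:
  assumes "\<not> alternating es" "set es \<subseteq> {1, - 1}"
  obtains us x vs where "es = us @ [x] @ [x] @ vs"
proof -
  from assms(1) obtain i where i: "Suc i < length es" "es ! i \<noteq> - es ! Suc i"
    by (auto simp: alternating_iff)
  have "es ! i \<in> set es" "es ! Suc i \<in> set es" using i(1) by auto
  with assms(2) have "es ! i \<in> {1, - 1}" "es ! Suc i \<in> {1, - 1}" by blast+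
  with i(2) have "es ! i = es ! Suc i" by auto
  with i(1) have "es = take i es @ [es ! i] @ [es ! i] @ drop (Suc (Suc i)) es"
    by (metis Cons_nth_drop_Suc Suc_lessD append_Cons append_Nil append_take_drop_id)
  then show thesis by (rule that)
qed

section \<open>Appell polynomials and cumulants of the signed letters\<close>

context free_from_scalars
begin

definition sign_letter :: "nat \<Rightarrow> int \<Rightarrow> 'a mat" where
  "sign_letter k e = letter (e * int k)"

definition sign_cumulant :: "nat \<Rightarrow> int list \<Rightarrow> 'a mat" where
  "sign_cumulant k es = free_cumulant scale \<tau> d (map (sign_letter k) es)"

definition alternating_cumulant :: "nat \<Rightarrow> int list \<Rightarrow> 'a mat" where
  "alternating_cumulant k es = (if even (length es) \<and> alternating es then sign_cumulant k es else 0\<^sub>m d d)"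

lemma sign_letter_carrier: "sign_letter k e \<in> carrier_mat d d"
  by (simp add: sign_letter_def letter_carrier)

lemma sign_cumulant_diag: "sign_cumulant k es \<in> diag_scalars scale d"
  by (simp add: sign_cumulant_def free_cumulant_diag_scalars)

lemma alternating_cumulant_diag: "alternating_cumulant k es \<in> diag_scalars scale d"
  by (simp add: alternating_cumulant_def sign_cumulant_diag diag_scalars_zero)

lemma cond_exp_appell_sign:
  assumes "es \<noteq> []"
  shows "cond_exp scale \<tau> d (appell d (sign_letter k) (sign_cumulant k) es) = 0\<^sub>m d d"
proof -
  have "appell d (sign_letter k) (sign_cumulant k) es =
      appell d id (free_cumulant scale \<tau> d) (map (sign_letter k) es)"
    by (simp add: appell_map sign_cumulant_def[abs_def])
  then show ?thesis
    using assms sign_letter_carrier by (simp only:) (rule cond_exp_appell, auto)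
qed

lemma sign_letter_mult_index:
  assumes "Z \<in> carrier_mat d d" "a < d" "b < d"
  shows "(sign_letter k e * Z) $$ (a, b) = X $$ (sh (e * int k) a, a) * Z $$ (sh (e * int k) a, b)"
proof -
  let ?c = "sh (e * int k) a"
  have "(sign_letter k e * Z) $$ (a, b) = (\<Sum>m<d. sign_letter k e $$ (a, m) * Z $$ (m, b))"
    by (rule mult_mat_index[OF sign_letter_carrier assms])
  also have "\<dots> = (\<Sum>m\<in>{?c}. sign_letter k e $$ (a, m) * Z $$ (m, b))"
    using assms shift_less by (intro sum.mono_neutral_right) (auto simp: sign_letter_def letter_index)
  finally show ?thesis using assms shift_less by (simp add: sign_letter_def letter_index)
qed

lemma corner_zero: "0 \<in> corner i j"
proof -
  have "entry_mat d i j (0 :: 'a) = 0\<^sub>m d d" by (rule eq_matI) (auto simp: entry_mat_def)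
  then show ?thesis using diag_scalars_zero by (simp add: corner_def alg_over_diag.diag)
qed

text \<open>
  The shape of an alternating word in the letters whose first sign is \<open>e\<close>: its walk stays on the edge from
  \<open>a\<close> to \<open>a + e k\<close>, and \<open>ev\<close> records whether it returns to \<open>a\<close>.
\<close>

definition alternating_mat :: "nat \<Rightarrow> int \<Rightarrow> bool \<Rightarrow> 'a mat \<Rightarrow> bool" where
  "alternating_mat k e ev Z \<longleftrightarrow> Z \<in> carrier_mat d d \<and> (\<forall>a<d. \<forall>b<d.
     if b = (if ev then a else sh (e * int k) a)
     then Z $$ (a, b) \<in> corner (sh (e * int k) a) (if ev then sh (e * int k) a else a)
     else Z $$ (a, b) = 0)"

lemma not_dvd_small: "x \<noteq> 0 \<Longrightarrow> \<bar>x\<bar> < int d \<Longrightarrow> \<not> int d dvd x"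
  using dvd_imp_le_int[of x "int d"] by auto

lemma alternating_mat_one: "alternating_mat k e True (1\<^sub>m d)"
  by (simp add: alternating_mat_def corner_one)

lemma alternating_mat_zero: "alternating_mat k e ev (0\<^sub>m d d)"
  by (simp add: alternating_mat_def corner_zero)

lemma alternating_mat_diff:
  "alternating_mat k e ev Y \<Longrightarrow> alternating_mat k e ev Z \<Longrightarrow> alternating_mat k e ev (Y - Z)"
proof -
  assume Y: "alternating_mat k e ev Y" and Z: "alternating_mat k e ev Z"
  have car: "Y \<in> carrier_mat d d" "Z \<in> carrier_mat d d"
    using Y Z by (simp_all only: alternating_mat_def)
  show ?thesis
    unfolding alternating_mat_def
  proof (intro conjI allI impI)
    fix a b assume ab: "a < d" "b < d"
    note YZ = Y[unfolded alternating_mat_def, THEN conjunct2, rule_format, OF ab]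
      Z[unfolded alternating_mat_def, THEN conjunct2, rule_format, OF ab]
    have "(Y - Z) $$ (a, b) = Y $$ (a, b) - Z $$ (a, b)" using car ab by simp
    with YZ show "if b = (if ev then a else sh (e * int k) a)
      then (Y - Z) $$ (a, b) \<in> corner (sh (e * int k) a) (if ev then sh (e * int k) a else a)
      else (Y - Z) $$ (a, b) = 0"
      by (cases "b = (if ev then a else sh (e * int k) a)") (simp_all add: corner_diff del: if_split)
  qed (rule minus_carrier_mat[OF car(2)])
qed

lemma alternating_mat_matsum:
  assumes "finite S" "\<And>s. s \<in> S \<Longrightarrow> alternating_mat k e ev (F s)"
  shows "alternating_mat k e ev (matsum d F S)"
proof -
  have "(\<Sum>s\<in>S. F s $$ (a, b)) \<in> corner i j" if "\<And>s. s \<in> S \<Longrightarrow> F s $$ (a, b) \<in> corner i j" for a b i j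
    using assms(1) that by (induction S) (auto simp: corner_zero corner_add)
  note corner_sum = this
  show ?thesis
    unfolding alternating_mat_def
  proof (intro conjI allI impI)
    fix a b assume ab: "a < d" "b < d"
    note F = assms(2)[unfolded alternating_mat_def, THEN conjunct2, rule_format, OF _ ab]
    show "if b = (if ev then a else sh (e * int k) a)
      then matsum d F S $$ (a, b) \<in> corner (sh (e * int k) a) (if ev then sh (e * int k) a else a)
      else matsum d F S $$ (a, b) = 0"
    proof (cases "b = (if ev then a else sh (e * int k) a)")
      case True
      with F ab show ?thesis by (simp add: matsum_def corner_sum del: if_split)
    next
      case False
      with F ab show ?thesis by (simp add: matsum_def sum.neutral del: if_split)
    qed
  qed (simp add: matsum_def)
qed

lemma alternating_mat_diag_mult:
  assumes D: "D \<in> diag_scalars scale d" and Z: "alternating_mat k e ev Z"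
  shows "alternating_mat k e ev (D * Z)"
proof -
  have Zc: "Z \<in> carrier_mat d d" using Z by (simp add: alternating_mat_def)
  have "\<exists>c. (D * Z) $$ (a, b) = scale c (Z $$ (a, b))" if ab: "a < d" "b < d" for a b
    using diag_scalars_entry[OF D ab(1)] unfolding diag_mult_index[OF D Zc ab]
    by (auto simp: scale_one_mult)
  then show ?thesis
    using Z diag_scalars_carrier[OF D] unfolding alternating_mat_def
    by (metis corner_scale mult_carrier_mat scale_zero_right)
qed

text \<open>The remaining walk starts with the opposite sign, so it goes back along the edge just
  used. The entry of \<open>X\<close> for the first step therefore composes with the corner of the
  rest, and the parity of the number of steps flips.\<close>

lemma alternating_mat_letter:
  assumes Z: "alternating_mat k (- e) ev Z"
  shows "alternating_mat k e (\<not> ev) (sign_letter k e * Z)"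
proof -
  have Zc: "Z \<in> carrier_mat d d" using Z by (simp add: alternating_mat_def)
  show ?thesis
    unfolding alternating_mat_def
  proof (intro conjI allI impI)
    show "sign_letter k e * Z \<in> carrier_mat d d" using Zc sign_letter_carrier by (rule mult_carrier_mat[rotated])
    fix a b assume ab: "a < d" "b < d"
    let ?c = "sh (e * int k) a"
    have c: "?c < d" using ab shift_less by simp
    have return: "sh (- e * int k) ?c = a" using ab by (simp add: shift_shift shift_zero)
    note Zcb = Z[unfolded alternating_mat_def, THEN conjunct2, rule_format, OF c ab(2), unfolded return]
    have Xc: "X $$ (?c, a) \<in> corner ?c a" by (rule corner_X[OF c ab(1)])
    show "if b = (if \<not> ev then a else ?c)
      then (sign_letter k e * Z) $$ (a, b) \<in> corner ?c (if \<not> ev then ?c else a)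
      else (sign_letter k e * Z) $$ (a, b) = 0"
      unfolding sign_letter_mult_index[OF Zc ab]
      using Zcb corner_mult[OF c ab(1) _ Xc] c ab by (cases ev) (auto split: if_splits)
  qed
qed

text \<open>Removing an initial segment of even length from an alternating word preserves the first
  sign and the parity of the length, hence the shape. Segments of odd length contribute nothing,
  because \<open>alternating_cumulant\<close> vanishes on them.\<close>

lemma alternating_mat_appell:
  "alternating es \<Longrightarrow> es = [] \<or> hd es = e \<Longrightarrow>
    alternating_mat k e (even (length es)) (appell d (sign_letter k) (alternating_cumulant k) es)"
proof (induction es arbitrary: e rule: length_induct)
  case (1 es)
  show ?case
  proof (cases es)
    case (Cons b fs)
    with 1 have b: "b = e" by simp
    have fs: "alternating fs" "fs = [] \<or> hd fs = - e"
      using 1(2) Cons b by (cases fs; simp)+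
    have first: "alternating_mat k e (even (length es)) (sign_letter k e *
        appell d (sign_letter k) (alternating_cumulant k) fs)"
      using alternating_mat_letter[OF 1(1)[rule_format, of fs "- e"]] fs Cons by simp
    have "alternating_mat k e (even (length es)) (alternating_cumulant k (take (Suc s) es) *
        appell d (sign_letter k) (alternating_cumulant k) (drop s fs))" if s: "s \<le> length fs" for s
    proof (cases "odd s")
      case True
      have ds: "drop s fs = drop (Suc s) es" using Cons by simp
      have "alternating (drop s fs)" using alternating_append[of "take s fs" "drop s fs"] fs(1) by simp
      moreover have "drop s fs = [] \<or> hd (drop s fs) = e"
        using alternating_hd_drop[OF fs(1), of s] fs(2) True s by (cases "s < length fs") auto
      moreover have "even (length (drop s fs)) = even (length es)"
        using Cons True s by simp
      moreover have "length (drop s fs) < length es" using Cons by simp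
      ultimately have "alternating_mat k e (even (length es)) (appell d (sign_letter k) (alternating_cumulant k) (drop s fs))"
        using 1(1)[rule_format, of "drop s fs" e] by simp
      then show ?thesis by (rule alternating_mat_diag_mult[OF alternating_cumulant_diag])
    next
      case False
      then have "alternating_cumulant k (take (Suc s) es) = 0\<^sub>m d d"
        using s Cons by (simp add: alternating_cumulant_def min_absorb2)
      then show ?thesis
        by (simp add: left_mult_zero_mat[OF appell_carrier] alternating_mat_zero)
    qed
    then have "alternating_mat k e (even (length es)) (matsum d (\<lambda>s. alternating_cumulant k (take (Suc s) es) *
        appell d (sign_letter k) (alternating_cumulant k) (drop s fs)) {..length fs})"
      by (intro alternating_mat_matsum) auto
    then show ?thesis
      using alternating_mat_diff[OF first] Cons b by simp
  qed (simp add: alternating_mat_one)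
qed

lemma alternating_last: "alternating es \<Longrightarrow> es \<noteq> [] \<Longrightarrow> last es = (if odd (length es) then hd es else - hd es)"
  using alternating_hd_drop[of es "length es - 1"]
  by (simp add: hd_drop_conv_nth last_conv_nth even_diff_nat)

text \<open>Each entry that the shape does not force to vanish is a single centered block: for even
  length it is on the diagonal and \<open>E\<close> centers it, for odd length it lies in an
  off-diagonal corner. The outer indices are the second vertex of the walk and the vertex before its
  end.\<close>

lemma alternating_appell_reduced:
  assumes k: "0 < k" "2 * k < d" and es: "alternating es" "es \<noteq> []" "set es \<subseteq> {1, - 1}"
    and E: "cond_exp scale \<tau> d (appell d (sign_letter k) (alternating_cumulant k) es) = 0\<^sub>m d d"
  shows "reduced_mat (\<lambda>a i. i = sh (hd es * int k) a) (\<lambda>b j. j = sh (- last es * int k) b)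
    (appell d (sign_letter k) (alternating_cumulant k) es)"
  unfolding reduced_mat_def
proof (intro conjI allI impI)
  let ?Z = "appell d (sign_letter k) (alternating_cumulant k) es"
  let ?e = "hd es"
  show "?Z \<in> carrier_mat d d" by (rule appell_carrier)
  have e: "?e = 1 \<or> ?e = - 1" using es(2,3) by (cases es) auto
  fix a b assume ab: "a < d" "b < d"
  let ?c = "sh (?e * int k) a"
  have c: "?c < d" using ab shift_less by simp
  \<comment> \<open>A step of size \<open>k\<close> is not a loop, because \<open>0 < k\<close> and
    \<open>k < d\<close>.\<close>
  have "\<not> int d dvd ?e * int k - 0"
    by (rule not_dvd_small) (use e k in auto)
  then have ac: "?c \<noteq> a" using shift_eq_iff[OF ab(1), of "?e * int k" 0] ab by (auto simp: shift_zero)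
  have Z: "if b = (if even (length es) then a else ?c)
     then ?Z $$ (a, b) \<in> corner ?c (if even (length es) then ?c else a) else ?Z $$ (a, b) = 0"
    using alternating_mat_appell[of es ?e k] es ab by (simp add: alternating_mat_def)
  have last: "last es = (if odd (length es) then ?e else - ?e)"
    using es by (rule_tac alternating_last)
  show "?Z $$ (a, b) \<in> span {w. \<exists>i j. i = ?c \<and> j = sh (- last es * int k) b \<and> reduced i j w}"
  proof (cases "b = (if even (length es) then a else ?c)")
    case False
    with Z show ?thesis by (simp add: span_zero)
  next
    case b: True
    show ?thesis
    proof (cases "even (length es)")
      case True
      with b have "b = a" by simp
      have "scale (\<tau> (?Z $$ (a, a))) 1 = 0"
        using arg_cong[OF E, of "\<lambda>A. A $$ (a, a)"] ab by (simp add: cond_exp_index)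
      then have "reduced ?c ?c (?Z $$ (a, b))"
        using Z True \<open>b = a\<close> c by (intro reduced.block) (auto simp: scale_eq_0_iff)
      moreover have "sh (- last es * int k) b = ?c" using last True \<open>b = a\<close> by simp
      ultimately show ?thesis by (intro span_base) auto
    next
      case False
      with b Z have "?Z $$ (a, b) \<in> corner ?c a" by simp
      then have "reduced ?c a (?Z $$ (a, b))"
        using c ab ac by (intro reduced.block tau_corner[of _ ?c a]) auto
      moreover have "sh (- last es * int k) b = a"
        using last False b ab by (simp add: shift_shift shift_zero)
      ultimately show ?thesis by (intro span_base) auto
    qed
  qed
qed

text \<open>A word with a repeated sign splits there by \<open>appell_break\<close> into two shorter
  words. For an alternating word only subwords on which the two cumulants agree enter, so the
  polynomial is the genuine one and is centered. Odd alternating words of length \<open>n\<close>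
  are excluded because agreement on them is not assumed.\<close>

lemma appell_reduced:
  assumes k: "0 < k" "2 * k < d"
    and agree: "\<And>es. set es \<subseteq> {1, - 1} \<Longrightarrow> length es < n \<Longrightarrow> sign_cumulant k es = alternating_cumulant k es"
  shows "es \<noteq> [] \<Longrightarrow> set es \<subseteq> {1, - 1} \<Longrightarrow> length es \<le> n \<Longrightarrow> \<not> (alternating es \<and> odd (length es) \<and> length es = n) \<Longrightarrow>
    reduced_mat (\<lambda>a i. i = sh (hd es * int k) a) (\<lambda>b j. j = sh (- last es * int k) b)
      (appell d (sign_letter k) (alternating_cumulant k) es)"
proof (induction es rule: length_induct)
  case (1 es)
  let ?A = "appell d (sign_letter k) (alternating_cumulant k)"
  show ?case
  proof (cases "alternating es")
    case True
    have "sign_cumulant k ys = alternating_cumulant k ys" if "es = xs @ ys @ zs" "ys \<noteq> []" for xs ys zs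
    proof (cases "length ys < n")
      case True
      then show ?thesis using agree that(1) 1(3) by auto
    next
      case False
      moreover have len: "length xs + length ys + length zs = length es" using that(1) by simp
      ultimately have "length xs = 0" "length zs = 0" "length es = n" using 1(4) by linarith+
      with that(1) have "ys = es" by simp
      with \<open>length es = n\<close> True 1(5) show ?thesis by (simp add: alternating_cumulant_def)
    qed
    then have "appell d (sign_letter k) (sign_cumulant k) es = ?A es"
      by (rule appell_cong)
    with cond_exp_appell_sign[OF 1(2), of k] show ?thesis
      using True 1(2,3) k by (intro alternating_appell_reduced) auto
  next
    case False
    then obtain us x vs where es: "es = us @ [x] @ [x] @ vs" using not_alternating_break 1(3) by blast
    have x: "x = 1 \<or> x = - 1" using 1(3) es by auto
    have "alternating_cumulant k (xs @ [x, x] @ ys) = 0\<^sub>m d d" for xs ys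
    proof -
      have "\<not> alternating ([x, x] @ ys)" using x by auto
      then have "\<not> alternating (xs @ [x, x] @ ys)" using alternating_append by blast
      then show ?thesis by (simp add: alternating_cumulant_def)
    qed
    then have "?A es = ?A (us @ [x]) * ?A ([x] @ vs)"
      unfolding es by (intro appell_break sign_letter_carrier diag_scalars_carrier[OF alternating_cumulant_diag])
    moreover have "reduced_mat (\<lambda>a i. i = sh (hd es * int k) a) (\<lambda>b j. j = sh (- last es * int k) b)
        (?A (us @ [x]) * ?A ([x] @ vs))"
    proof (rule reduced_mat_mult)
      have "reduced_mat (\<lambda>a i. i = sh (hd (us @ [x]) * int k) a) (\<lambda>b j. j = sh (- last (us @ [x]) * int k) b) (?A (us @ [x]))"
        using 1(1)[rule_format, of "us @ [x]"] 1(3,4) es by (simp del: appell.simps)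
      then show "reduced_mat (\<lambda>a i. i = sh (hd es * int k) a) (\<lambda>b j. j = sh (- x * int k) b) (?A (us @ [x]))"
        by (cases us) (simp_all add: es del: appell.simps)
      have "reduced_mat (\<lambda>a i. i = sh (hd ([x] @ vs) * int k) a) (\<lambda>b j. j = sh (- last ([x] @ vs) * int k) b) (?A ([x] @ vs))"
        using 1(1)[rule_format, of "[x] @ vs"] 1(3,4) es by (simp del: appell.simps)
      then show "reduced_mat (\<lambda>a i. i = sh (x * int k) a) (\<lambda>b j. j = sh (- last es * int k) b) (?A ([x] @ vs))"
        by (simp add: es del: appell.simps)
      fix b i j assume b: "b < d" "i = sh (- x * int k) b" "j = sh (x * int k) b"
      \<comment> \<open>At \<open>b\<close> the walk arrives by a step \<open>x * k\<close> and
        leaves by the same step. The vertices before and after \<open>b\<close> differ by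
        \<open>2 * k\<close> up to sign, which is nonzero modulo \<open>d\<close> since
        \<open>0 < 2 * k < d\<close>.\<close>
      have "\<not> int d dvd - x * int k - x * int k"
        by (rule not_dvd_small) (use x k in auto)
      then show "i \<noteq> j" using shift_eq_iff[OF b(1)] b by blast
    qed
    ultimately show ?thesis by simp
  qed
qed

text \<open>By induction the two families agree on shorter words, so where the replacement is zero
  the two Appell polynomials differ exactly by the cumulant of the whole word. Both polynomials have
  expectation zero, and the cumulant, being a diagonal scalar, is its own expectation.\<close>

theorem sign_cumulant_alternating:
  assumes k: "0 < k" "2 * k < d"
  shows "set es \<subseteq> {1, - 1} \<Longrightarrow> sign_cumulant k es = alternating_cumulant k es"
proof (induction es rule: length_induct)
  case (1 es)
  let ?K = "sign_cumulant k" and ?K' = "alternating_cumulant k"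
  let ?A = "\<lambda>\<kappa>. appell d (sign_letter k) \<kappa>" and ?E = "cond_exp scale \<tau> d"
  show ?case
  proof (cases "even (length es) \<and> alternating es")
    case True
    then show ?thesis by (simp add: alternating_cumulant_def)
  next
    case False
    then have K'0: "?K' es = 0\<^sub>m d d" by (simp only: alternating_cumulant_def if_False)
    obtain e fs where es: "es = e # fs" using False by (cases es) auto
    have agree: "?K ys = ?K' ys" if "set ys \<subseteq> {1, - 1}" "length ys < length es" for ys
      using 1(1) that by blast
    have A: "?A ?K (drop s fs) = ?A ?K' (drop s fs)" for s
    proof (rule appell_cong)
      fix xs ys zs assume d: "drop s fs = xs @ ys @ zs"
      have "set ys \<subseteq> set fs" using set_drop_subset[of s fs] by (simp add: d)
      moreover have "length (drop s fs) = length xs + length ys + length zs" by (simp only: d length_append)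
      then have "length ys \<le> length fs" by simp
      ultimately show "?K ys = ?K' ys" using 1(2) es by (intro agree) auto
    qed
    let ?t = "\<lambda>\<kappa> s. \<kappa> (take (Suc s) es) * ?A ?K' (drop s fs)"
    have t: "?t ?K s = ?t ?K' s" if "s < length fs" for s
    proof -
      have "set (take (Suc s) es) \<subseteq> {1, - 1}" using 1(2) set_take_subset by (rule order_trans[rotated])
      moreover have "length (take (Suc s) es) < length es" using that es by simp
      ultimately show ?thesis by (simp only: agree)
    qed
    have "?A ?K es = sign_letter k e * ?A ?K' fs - matsum d (?t ?K) {..length fs}"
      using A A[of 0] es by simp
    moreover have "?A ?K' es = sign_letter k e * ?A ?K' fs - matsum d (?t ?K') {..length fs}"
      using es by simp
    \<comment> \<open>The index \<open>length fs\<close> belongs to the whole word: the remaining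
      Appell factor is the identity there, and \<open>?K'\<close> vanishes.\<close>
    moreover have "matsum d (?t ?K) {..length fs} = matsum d (?t ?K') {..length fs} + ?K es"
    proof (rule eq_matI)
      fix i j assume "i < dim_row (matsum d (?t ?K') {..length fs} + ?K es)"
        "j < dim_col (matsum d (?t ?K') {..length fs} + ?K es)"
      then have ij: "i < d" "j < d"
        using diag_scalars_carrier[OF sign_cumulant_diag[of k es]] by auto
      have "{..length fs} = insert (length fs) {..<length fs}" by auto
      moreover have "?t ?K (length fs) = ?K es" "?t ?K' (length fs) = 0\<^sub>m d d"
        using K'0 es right_mult_one_mat[OF diag_scalars_carrier[OF sign_cumulant_diag[of k es]]] by simp_all
      moreover have "(\<Sum>s<length fs. ?t ?K s $$ (i, j)) = (\<Sum>s<length fs. ?t ?K' s $$ (i, j))"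
        using t by simp
      ultimately show "matsum d (?t ?K) {..length fs} $$ (i, j) =
          (matsum d (?t ?K') {..length fs} + ?K es) $$ (i, j)"
        using ij diag_scalars_carrier[OF sign_cumulant_diag[of k es]]
        by (simp add: matsum_def del: index_mult_mat(1))
    qed (use diag_scalars_carrier[OF sign_cumulant_diag[of k es]] in \<open>auto simp: matsum_def\<close>)
    ultimately have "?A ?K' es - ?A ?K es = ?K es"
      using diag_scalars_carrier[OF sign_cumulant_diag[of k es]] sign_letter_carrier[of k e]
        appell_carrier[of d "sign_letter k" ?K' fs]
      by (intro eq_matI) (auto simp: matsum_def simp del: index_mult_mat(1))
    then have "?E (?K es) = ?E (?A ?K' es) - ?E (?A ?K es)"
      using cond_exp_minus[OF appell_carrier appell_carrier] by metis
    moreover have "?E (?A ?K es) = 0\<^sub>m d d" using cond_exp_appell_sign[of es k] es by (simp del: appell.simps)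
    moreover have "?E (?A ?K' es) = 0\<^sub>m d d"
    \<comment> \<open>Odd alternating words are not covered by \<open>appell_reduced\<close>. Their
      polynomial has zero diagonal, because the walk ends at the other end of its edge.\<close>
    proof (cases "alternating es")
      case True
      with False have "odd (length es)" by simp
      show ?thesis
      proof (rule eq_matI)
        fix a b assume "a < dim_row (0\<^sub>m d d :: 'a mat)" "b < dim_col (0\<^sub>m d d :: 'a mat)"
        then have ab: "a < d" "b < d" by auto
        have "e = 1 \<or> e = - 1" using 1(2) es by auto
        then have "\<not> int d dvd 0 - e * int k"
          by (intro not_dvd_small) (use k in auto)
        then have "a \<noteq> sh (e * int k) a"
          using shift_eq_iff[OF ab(1), of 0 "e * int k"] ab by (auto simp: shift_zero)
        then have "?A ?K' es $$ (a, a) = 0"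
          using alternating_mat_appell[OF True, of e k] \<open>odd (length es)\<close> ab es
          by (auto simp: alternating_mat_def)
        then show "?E (?A ?K' es) $$ (a, b) = 0\<^sub>m d d $$ (a, b)"
          using ab by (cases "a = b") (auto simp: cond_exp_index)
      qed (use carrier_matD[OF cond_exp_carrier] in auto)
    next
      case False
      then show ?thesis
        using 1(2) es agree by (intro cond_exp_reduced_mat[OF appell_reduced[OF k, of "length es"]]) auto
    qed
    ultimately have "?K es = 0\<^sub>m d d"
      using cond_exp_diag[OF sign_cumulant_diag[of k es]] by simp
    with K'0 show ?thesis by simp
  qed
qed

lemma R_diagonal_pair_letters:
  assumes "0 < k" "2 * k < d"
  shows "R_diagonal_pair scale \<tau> d (letter (int k)) (letter (- int k))"
  unfolding R_diagonal_pair_def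
proof (intro allI impI)
  fix es :: "int list"
  assume es: "set es \<subseteq> {1, - 1}"
    and bad: "\<not> (even (length es) \<and> (\<forall>i. Suc i < length es \<longrightarrow> es ! i = - es ! Suc i))"
  have "map (\<lambda>e. if e = 1 then letter (int k) else letter (- int k)) es = map (sign_letter k) es"
    using es by (auto simp: sign_letter_def)
  then have "free_cumulant scale \<tau> d (map (\<lambda>e. if e = 1 then letter (int k) else letter (- int k)) es) =
      sign_cumulant k es"
    by (simp only: sign_cumulant_def)
  also have "\<dots> = 0\<^sub>m d d"
    using sign_cumulant_alternating[OF assms es] bad by (auto simp: alternating_cumulant_def alternating_iff)
  finally show "free_cumulant scale \<tau> d (map (\<lambda>e. if e = 1 then letter (int k) else letter (- int k)) es) = 0\<^sub>m d d" .
qed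

end

theorem theorem24:
  fixes scale :: "complex \<Rightarrow> 'a::ring_1 \<Rightarrow> 'a"
    and \<tau> :: "'a \<Rightarrow> complex"
    and d :: nat
    and X :: "'a mat"
    and Y :: "nat \<Rightarrow> 'a mat"
  assumes "nc_prob_space scale \<tau>"
    and "d \<ge> 1"
    and "X \<in> carrier_mat d d"
    and "free_from_scalar_mats scale \<tau> d X"
    and "Y = (\<lambda>k. diag_part d (transpose_mat X) k)"
  shows "(even d \<longrightarrow>
            free_sets scale \<tau> d {0..d div 2}
              (\<lambda>k. if k = 0 \<or> k = d div 2 then {Y k} else {Y k, Y (d - k)}) \<and>
            (\<forall>i\<in>{1..d div 2 - 1}. R_diagonal_pair scale \<tau> d (Y i) (Y (d - i)))) \<and>
         (odd d \<longrightarrow>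
            free_sets scale \<tau> d {0..(d - 1) div 2}
              (\<lambda>k. if k = 0 then {Y 0} else {Y k, Y (d - k)}) \<and>
            (\<forall>i\<in>{1..(d - 1) div 2}. R_diagonal_pair scale \<tau> d (Y i) (Y (d - i))))"
proof -
  interpret nc_prob_space scale \<tau> by fact
  interpret free_from_scalars scale \<tau> d X by unfold_locales fact+
  have Y: "Y k = letter (int k)" for k
    by (simp add: assms(5) diag_part_transpose)
  have Y': "Y (d - k) = letter (- int k)" if "k \<le> d" for k
    using letter_minus[OF that] by (simp only: Y)
  have R: "R_diagonal_pair scale \<tau> d (Y i) (Y (d - i))" if "0 < i" "2 * i < d" for i
  proof -
    have id: "i \<le> d" using that by simp
    from R_diagonal_pair_letters[OF that] show ?thesis unfolding Y'[OF id] unfolding Y .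
  qed
  \<comment> \<open>\<open>free_letter_pairs\<close> asks only that each set lie inside the pair of
    letters for its \<open>k\<close>, which also covers the singletons.\<close>
  have F: "free_sets scale \<tau> d {0..d div 2} (\<lambda>k. if k = 0 \<or> k = d div 2 then {Y k} else {Y k, Y (d - k)})"
    by (rule free_letter_pairs) (auto simp: Y letter_minus simp del: of_nat_diff)
  have F': "free_sets scale \<tau> d {0..(d - 1) div 2} (\<lambda>k. if k = 0 then {Y 0} else {Y k, Y (d - k)})"
    by (rule free_letter_pairs) (auto simp: Y letter_minus simp del: of_nat_diff)
  show ?thesis
  proof (intro conjI impI ballI F F')
    fix i assume "i \<in> {1..d div 2 - 1}"
    then show "R_diagonal_pair scale \<tau> d (Y i) (Y (d - i))" by (intro R) auto
  next
    fix i assume "i \<in> {1..(d - 1) div 2}" "odd d"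
    then show "R_diagonal_pair scale \<tau> d (Y i) (Y (d - i))" by (intro R) auto
  qed
qed

end
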